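(* Let $M\subset\mathbb{R}^n$ be a compact Riemannian manifold of dimension $k$, regarded as a probability space with respect to the normalized $k$-dimensional Hausdorff measure $\mu$. For each $m\ge1$ let $P^m$ be an i.i.d. sample of $M$ of size $m$. For any stable and homotopy invariant distance $d$ on $\mathbb{R}$-spaces, $d(\check{\mathcal{C}}(P^m),O(M))$ converges in probability to $0$ as $m\to\infty$; that is, for every $\epsilon>0$, $$\lim_{m\to\infty}\mathbb{P}\big(d(\check{\mathcal{C}}(P^m),O(M))>\epsilon\big)=0.$$
   Context: $\mathbf{Top}$ is the category of compactly generated weakly Hausdorff (CGWH) spaces and continuous maps; all topological constructions are carried out in it. Regard $\mathbb{R}$ with its usual order as a category. An $\mathbb{R}$-space is a functor $\mathbb{R}\to\mathbf{Top}$; morphisms are natural transformations. Abstract simplicial complexes are regarded as spaces via geometric realization. A distance on $\mathbb{R}$-spaces is an extended pseudometric on the class of $\mathbb{R}$-spaces (symmetric, values in $[0,\infty]$, triangle inequality, $d(X,X)=0$). For $T\in\mathbf{Top}$ and a (not necessarily continuous) function $\gamma\colon T\to\mathbb{R}$, $\mathcal{S}(\gamma)$ is the $\mathbb{R}$-space $\mathcal{S}(\gamma)_r=\gamma^{-1}(-\infty,r]$ with the subspace topology (in the CGWH sense, i.e. the k-ification of the usual subspace topology) and internal maps the inclusions; $d_\infty(\gamma,\kappa)=\sup_{x\in T}|\gamma(x)-\kappa(x)|$. A natural transformation $f\colon X\to Y$ of $\mathbb{R}$-spaces is an (objectwise) weak equivalence if each $f_r$ is a weak homotopy equivalence; $X\simeq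 Y$ means that $X$ and $Y$ are connected by a finite zigzag of objectwise weak equivalences. $d$ is stable if $d(\mathcal{S}(\gamma),\mathcal{S}(\kappa))\le d_\infty(\gamma,\kappa)$ for every $T\in\mathbf{Top}$ and all functions $\gamma,\kappa\colon T\to\mathbb{R}$; it is homotopy invariant if $d(X,Y)=0$ whenever $X\simeq Y$. Offset and Čech filtrations: fix $p\in[1,\infty]$. For $x\in\mathbb{R}^n$ and $r\in\mathbb{R}$ let $B(x,r)=\{y\in\mathbb{R}^n\mid\|x-y\|_p\le r\}$. For $P\subset\mathbb{R}^n$, the offset filtration is $O(P)_r=\bigcup_{x\in P}B(x,r)$ with internal maps the inclusions. The Čech filtration $\check{\mathcal{C}}(P)$ has $\check{\mathcal{C}}(P)_r$ equal to the nerve of $\{B(x,r)\}_{x\in P}$, i.e. the simplicial complex whose simplices are the finite nonempty $\sigma\subset P$ with $\bigcap_{x\in\sigma}B(x,r)\ne\emptyset$; internal maps are inclusions. Both are regarded as $\mathbb{R}$-spaces, being empty at indices $r<0$. *)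

theory Defs
  imports "HOL-Probability.Probability"
begin

section \<open>Compactly generated weakly Hausdorff spaces\<close>

text \<open>
  HOL cannot quantify over types inside a formula, so the compact Hausdorff test spaces \<open>K\<close> for a
  space with points in \<open>'a\<close> are taken with points in \<open>'a set set\<close>. This loses nothing. If
  \<open>u : K \<rightarrow> X\<close> is a test map on an arbitrary compact Hausdorff space with image \<open>C\<close>, a section
  \<open>C \<rightarrow> K\<close> of \<open>u\<close> extends to the Stone-Cech compactification \<open>\<beta>C\<close> of the discrete set \<open>C\<close>, whose points
  are ultrafilters, i.e. elements of \<open>'a set set\<close>; the composite \<open>\<beta>C \<rightarrow> K \<rightarrow> X\<close> still has image \<open>C\<close>. So the
  weak Hausdorff condition is the usual one. For a weakly Hausdorff \<open>X\<close>, each \<open>u : K \<rightarrow> X\<close> is a closed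
  map onto a compact Hausdorff subspace of \<open>X\<close>, and such a subspace has a copy in \<open>'a set set\<close>; so
  the k-open sets are the usual ones as well.
\<close>

definition weakly_Hausdorff_space :: "'a topology \<Rightarrow> bool" where
  "weakly_Hausdorff_space X \<longleftrightarrow>
     (\<forall>(K :: 'a set set topology) u.
        compact_space K \<and> Hausdorff_space K \<and> continuous_map K X u
          \<longrightarrow> closedin X (u ` topspace K))"

definition k_open :: "'a topology \<Rightarrow> 'a set \<Rightarrow> bool" where
  "k_open X U \<longleftrightarrow> U \<subseteq> topspace X \<and>
     (\<forall>(K :: 'a set set topology) u.
        compact_space K \<and> Hausdorff_space K \<and> continuous_map K X u
          \<longrightarrow> openin K {x \<in> topspace K. u x \<in> U})"

definition compactly_generated_space :: "'a topology \<Rightarrow> bool" where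
  "compactly_generated_space X \<longleftrightarrow> (\<forall>U. k_open X U \<longrightarrow> openin X U)"

definition CGWH :: "'a topology \<Rightarrow> bool" where
  "CGWH X \<longleftrightarrow> compactly_generated_space X \<and> weakly_Hausdorff_space X"

text \<open>The library's \<^const>\<open>kification\<close> tests against all compact subspaces, Hausdorff or not.\<close>

definition cg_ification :: "'a topology \<Rightarrow> 'a topology" where
  "cg_ification X = topology (k_open X)"

lemma istopology_k_open: "istopology (k_open X)"
  unfolding istopology_def
proof (intro conjI allI impI)
  fix S T assume ST: "k_open X S" "k_open X T"
  have eq: "{x \<in> topspace K. u x \<in> S \<inter> T} = {x \<in> topspace K. u x \<in> S} \<inter> {x \<in> topspace K. u x \<in> T}"
    for K :: "'a set set topology" and u by blast
  show "k_open X (S \<inter> T)"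
    using ST unfolding k_open_def eq by blast
next
  fix \<K> assume *: "\<forall>S\<in>\<K>. k_open X S"
  have eq: "{x \<in> topspace K. u x \<in> \<Union>\<K>} = (\<Union>S\<in>\<K>. {x \<in> topspace K. u x \<in> S})"
    for K :: "'a set set topology" and u by blast
  show "k_open X (\<Union>\<K>)"
    using * unfolding k_open_def eq by (auto intro!: openin_Union)
qed

lemma openin_cg_ification: "openin (cg_ification X) = k_open X"
  unfolding cg_ification_def by (rule topology_inverse'[OF istopology_k_open])


section \<open>Weak homotopy equivalences\<close>

definition cube :: "nat \<Rightarrow> (nat \<Rightarrow> real) set" where
  "cube n = {t. (\<forall>i<n. 0 \<le> t i \<and> t i \<le> 1) \<and> (\<forall>i\<ge>n. t i = 0)}"

definition cube_boundary :: "nat \<Rightarrow> (nat \<Rightarrow> real) set" where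
  "cube_boundary n = {t \<in> cube n. \<exists>i<n. t i = 0 \<or> t i = 1}"

text \<open>\<open>\<pi>\<^sub>n(X, x)\<close> as the set of homotopy classes of maps of pairs from the \<open>n\<close>-cube and its boundary
  to \<open>(X, x)\<close>. The group law is not needed: induced maps are homomorphisms for \<open>n \<ge> 1\<close>, so they are
  isomorphisms iff they are bijective.\<close>

definition loop_homotopy ::
    "nat \<Rightarrow> 'a topology \<Rightarrow> 'a \<Rightarrow> ((nat \<Rightarrow> real) \<Rightarrow> 'a) rel" where
  "loop_homotopy n X x =
     {(g, h). homotopic_with (\<lambda>q. \<forall>t\<in>cube_boundary n. q t = x) (top_of_set (cube n)) X g h}"

definition loops :: "nat \<Rightarrow> 'a topology \<Rightarrow> 'a \<Rightarrow> ((nat \<Rightarrow> real) \<Rightarrow> 'a) set" where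
  "loops n X x =
     {g. continuous_map (top_of_set (cube n)) X g \<and> (\<forall>t\<in>cube_boundary n. g t = x)}"

definition homotopy_group ::
    "nat \<Rightarrow> 'a topology \<Rightarrow> 'a \<Rightarrow> ((nat \<Rightarrow> real) \<Rightarrow> 'a) set set" where
  "homotopy_group n X x = loops n X x // loop_homotopy n X x"

definition homotopy_group_map ::
    "nat \<Rightarrow> 'b topology \<Rightarrow> ('a \<Rightarrow> 'b) \<Rightarrow> 'a
      \<Rightarrow> ((nat \<Rightarrow> real) \<Rightarrow> 'a) set \<Rightarrow> ((nat \<Rightarrow> real) \<Rightarrow> 'b) set" where
  "homotopy_group_map n Y f x c = loop_homotopy n Y (f x) `` ((\<lambda>g. f \<circ> g) ` c)"

definition path_components_map ::
    "'b topology \<Rightarrow> ('a \<Rightarrow> 'b) \<Rightarrow> 'a set \<Rightarrow> 'b set" where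
  "path_components_map Y f C = (\<Union>c\<in>C. path_component_of_set Y (f c))"

definition weak_homotopy_equivalence ::
    "'a topology \<Rightarrow> 'b topology \<Rightarrow> ('a \<Rightarrow> 'b) \<Rightarrow> bool" where
  "weak_homotopy_equivalence X Y f \<longleftrightarrow>
     continuous_map X Y f \<and>
     bij_betw (path_components_map Y f) (path_components_of X) (path_components_of Y) \<and>
     (\<forall>n\<ge>1. \<forall>x\<in>topspace X.
        bij_betw (homotopy_group_map n Y f x) (homotopy_group n X x) (homotopy_group n Y (f x)))"


section \<open>\<open>\<real>\<close>-spaces\<close>

text \<open>Only \<open>arr X r s\<close> for \<open>r \<le> s\<close>, on the points of \<open>obj X r\<close>, is meaningful; \<open>\<real>\<close>-spaces that differ
  elsewhere are weakly equivalent through identity maps.\<close>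

datatype 'a rspace =
  RSpace (obj: "real \<Rightarrow> 'a topology") (arr: "real \<Rightarrow> real \<Rightarrow> 'a \<Rightarrow> 'a")

definition is_rspace :: "'a rspace \<Rightarrow> bool" where
  "is_rspace X \<longleftrightarrow>
     (\<forall>r. CGWH (obj X r)) \<and>
     (\<forall>r s. r \<le> s \<longrightarrow> continuous_map (obj X r) (obj X s) (arr X r s)) \<and>
     (\<forall>r. \<forall>x\<in>topspace (obj X r). arr X r r x = x) \<and>
     (\<forall>r s t. r \<le> s \<longrightarrow> s \<le> t \<longrightarrow>
        (\<forall>x\<in>topspace (obj X r). arr X s t (arr X r s x) = arr X r t x))"

definition natural_transformation ::
    "'a rspace \<Rightarrow> 'b rspace \<Rightarrow> (real \<Rightarrow> 'a \<Rightarrow> 'b) \<Rightarrow> bool" where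
  "natural_transformation X Y f \<longleftrightarrow>
     (\<forall>r. continuous_map (obj X r) (obj Y r) (f r)) \<and>
     (\<forall>r s. r \<le> s \<longrightarrow>
        (\<forall>x\<in>topspace (obj X r). f s (arr X r s x) = arr Y r s (f r x)))"

definition objectwise_weak_equivalence ::
    "'a rspace \<Rightarrow> 'b rspace \<Rightarrow> (real \<Rightarrow> 'a \<Rightarrow> 'b) \<Rightarrow> bool" where
  "objectwise_weak_equivalence X Y f \<longleftrightarrow>
     natural_transformation X Y f \<and>
     (\<forall>r. weak_homotopy_equivalence (obj X r) (obj Y r) (f r))"

definition weakly_equivalent :: "'a rspace \<Rightarrow> 'a rspace \<Rightarrow> bool" where
  "weakly_equivalent =
     equivclp (\<lambda>X Y. is_rspace X \<and> is_rspace Y \<and> (\<exists>f. objectwise_weak_equivalence X Y f))"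

definition sublevel_rspace :: "'a topology \<Rightarrow> ('a \<Rightarrow> real) \<Rightarrow> 'a rspace" where
  "sublevel_rspace T \<gamma> =
     RSpace (\<lambda>r. cg_ification (subtopology T {x \<in> topspace T. \<gamma> x \<le> r})) (\<lambda>r s x. x)"

definition sup_distance :: "'a topology \<Rightarrow> ('a \<Rightarrow> real) \<Rightarrow> ('a \<Rightarrow> real) \<Rightarrow> ennreal" where
  "sup_distance T \<gamma> \<kappa> = (SUP x\<in>topspace T. ennreal \<bar>\<gamma> x - \<kappa> x\<bar>)"


section \<open>Distances on \<open>\<real>\<close>-spaces\<close>

definition rspace_distance :: "('u rspace \<Rightarrow> 'u rspace \<Rightarrow> ennreal) \<Rightarrow> bool" where
  "rspace_distance d \<longleftrightarrow>
     (\<forall>X. is_rspace X \<longrightarrow> d X X = 0) \<and>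
     (\<forall>X Y. is_rspace X \<longrightarrow> is_rspace Y \<longrightarrow> d X Y = d Y X) \<and>
     (\<forall>X Y Z. is_rspace X \<longrightarrow> is_rspace Y \<longrightarrow> is_rspace Z \<longrightarrow> d X Z \<le> d X Y + d Y Z)"

definition stable_distance :: "('u rspace \<Rightarrow> 'u rspace \<Rightarrow> ennreal) \<Rightarrow> bool" where
  "stable_distance d \<longleftrightarrow>
     (\<forall>T \<gamma> \<kappa>. CGWH T \<longrightarrow> d (sublevel_rspace T \<gamma>) (sublevel_rspace T \<kappa>) \<le> sup_distance T \<gamma> \<kappa>)"

definition homotopy_invariant_distance :: "('u rspace \<Rightarrow> 'u rspace \<Rightarrow> ennreal) \<Rightarrow> bool" where
  "homotopy_invariant_distance d \<longleftrightarrow>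
     (\<forall>X Y. is_rspace X \<longrightarrow> is_rspace Y \<longrightarrow> weakly_equivalent X Y \<longrightarrow> d X Y = 0)"

text \<open>The class of all \<open>\<real>\<close>-spaces is modelled by the \<open>\<real>\<close>-spaces whose points lie in a type \<open>'u\<close>.
  An \<open>\<real>\<close>-space on another type is regarded as one on \<open>'u\<close> by transport along an injection; since the
  result is unique up to isomorphism, the choice does not matter for homotopy invariant distances.\<close>

definition transport_rspace :: "('a \<Rightarrow> 'u) \<Rightarrow> 'a rspace \<Rightarrow> 'u rspace" where
  "transport_rspace e X =
     RSpace (\<lambda>r. pullback_topology (e ` topspace (obj X r)) (inv e) (obj X r))
            (\<lambda>r s. e \<circ> arr X r s \<circ> inv e)"


section \<open>Offset and Cech filtrations\<close>

definition pnorm :: "ereal \<Rightarrow> real ^ 'n \<Rightarrow> real" where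
  "pnorm p x =
     (if p = \<infinity> then Max (range (\<lambda>i. \<bar>x $ i\<bar>))
      else (\<Sum>i\<in>UNIV. \<bar>x $ i\<bar> powr real_of_ereal p) powr (1 / real_of_ereal p))"

definition pball :: "ereal \<Rightarrow> real ^ 'n \<Rightarrow> real \<Rightarrow> (real ^ 'n) set" where
  "pball p x r = {y. pnorm p (x - y) \<le> r}"

definition offset :: "ereal \<Rightarrow> (real ^ 'n) set \<Rightarrow> (real ^ 'n) rspace" where
  "offset p P = RSpace (\<lambda>r. top_of_set (\<Union>x\<in>P. pball p x r)) (\<lambda>r s x. x)"

definition nerve :: "'i set \<Rightarrow> ('i \<Rightarrow> 'a set) \<Rightarrow> 'i set set" where
  "nerve I B = {\<sigma>. finite \<sigma> \<and> \<sigma> \<noteq> {} \<and> \<sigma> \<subseteq> I \<and> (\<Inter>i\<in>\<sigma>. B i) \<noteq> {}}"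

text \<open>Points of the geometric realization of a simplicial complex are given by their barycentric
  coordinates. The topology is the weak one: a set is open iff its trace on every closed simplex is
  open in the Euclidean topology of that simplex.\<close>

definition realization_points :: "'i set set \<Rightarrow> ('i \<Rightarrow> real) set" where
  "realization_points S =
     {a. (\<forall>i. 0 \<le> a i) \<and> {i. a i \<noteq> 0} \<in> S \<and> (\<Sum>i | a i \<noteq> 0. a i) = 1}"

definition closed_simplex :: "'i set \<Rightarrow> ('i \<Rightarrow> real) set" where
  "closed_simplex \<sigma> = {a. (\<forall>i. 0 \<le> a i) \<and> {i. a i \<noteq> 0} \<subseteq> \<sigma> \<and> sum a \<sigma> = 1}"

definition realization_open :: "'i set set \<Rightarrow> ('i \<Rightarrow> real) set \<Rightarrow> bool" where
  "realization_open S U \<longleftrightarrow> U \<subseteq> realization_points S \<and>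
     (\<forall>\<sigma>\<in>S. openin (top_of_set (closed_simplex \<sigma>)) (U \<inter> closed_simplex \<sigma>))"

definition geometric_realization :: "'i set set \<Rightarrow> ('i \<Rightarrow> real) topology" where
  "geometric_realization S = topology (realization_open S)"

lemma istopology_realization_open: "istopology (realization_open S)"
  unfolding istopology_def
proof (intro conjI allI impI)
  fix U V assume UV: "realization_open S U" "realization_open S V"
  have eq: "U \<inter> V \<inter> A = (U \<inter> A) \<inter> (V \<inter> A)" for A by blast
  show "realization_open S (U \<inter> V)"
    using UV unfolding realization_open_def eq by (blast intro: openin_Int)
next
  fix \<K> assume *: "\<forall>U\<in>\<K>. realization_open S U"
  have "openin (top_of_set (closed_simplex \<sigma>)) (\<Union>\<K> \<inter> closed_simplex \<sigma>)" if "\<sigma> \<in> S" for \<sigma>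
  proof -
    have "\<Union>\<K> \<inter> closed_simplex \<sigma> = \<Union>((\<lambda>U. U \<inter> closed_simplex \<sigma>) ` \<K>)" by blast
    moreover have "openin (top_of_set (closed_simplex \<sigma>)) (\<Union>((\<lambda>U. U \<inter> closed_simplex \<sigma>) ` \<K>))"
      using * that unfolding realization_open_def by (intro openin_Union) blast
    ultimately show ?thesis by simp
  qed
  moreover have "\<Union>\<K> \<subseteq> realization_points S"
    using * unfolding realization_open_def by blast
  ultimately show "realization_open S (\<Union>\<K>)"
    unfolding realization_open_def by blast
qed

lemma openin_geometric_realization: "openin (geometric_realization S) = realization_open S"
  unfolding geometric_realization_def by (rule topology_inverse'[OF istopology_realization_open])

definition cech :: "ereal \<Rightarrow> (real ^ 'n) set \<Rightarrow> (real ^ 'n \<Rightarrow> real) rspace" where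
  "cech p P =
     RSpace (\<lambda>r. geometric_realization (nerve P (\<lambda>x. pball p x r))) (\<lambda>r s a. a)"


section \<open>Submanifolds of Euclidean space and Hausdorff measure\<close>

text \<open>Continuity of all iterated directional derivatives, for functions on an open set.\<close>

primrec Ck_on :: "nat \<Rightarrow> ('a::euclidean_space \<Rightarrow> 'b::euclidean_space) \<Rightarrow> 'a set \<Rightarrow> bool" where
  "Ck_on 0 f U \<longleftrightarrow> continuous_on U f"
| "Ck_on (Suc m) f U \<longleftrightarrow>
     (\<forall>x\<in>U. f differentiable (at x)) \<and>
     (\<forall>v. Ck_on m (\<lambda>x. frechet_derivative f (at x) v) U)"

definition smooth_map_on :: "('a::euclidean_space \<Rightarrow> 'b::euclidean_space) \<Rightarrow> 'a set \<Rightarrow> bool" where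
  "smooth_map_on f U \<longleftrightarrow> (\<forall>m. Ck_on m f U)"

text \<open>Smooth embedded submanifolds without boundary, given by slice charts. The Riemannian metric is the
  one induced from the ambient Euclidean space, hence no additional datum; its volume measure is the
  \<open>k\<close>-dimensional Hausdorff measure for the Euclidean distance.\<close>

definition smooth_submanifold :: "nat \<Rightarrow> ('a::euclidean_space) set \<Rightarrow> bool" where
  "smooth_submanifold k M \<longleftrightarrow>
     (\<forall>x\<in>M. \<exists>U V \<phi> \<psi> S.
        open U \<and> x \<in> U \<and> open V \<and>
        smooth_map_on \<phi> U \<and> smooth_map_on \<psi> V \<and>
        \<phi> ` U = V \<and> (\<forall>u\<in>U. \<psi> (\<phi> u) = u) \<and> (\<forall>v\<in>V. \<phi> (\<psi> v) = v) \<and>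
        subspace S \<and> dim S = k \<and> \<phi> ` (U \<inter> M) = (V \<inter> S :: 'a set))"

text \<open>The customary normalizing constant of the Hausdorff measure is omitted; it cancels in the
  normalized measure below. The case split makes the \<open>0\<close>-dimensional measure ignore empty sets of
  a cover, so that it is the counting measure.\<close>

definition hausdorff_gauge :: "nat \<Rightarrow> ('a::metric_space) set \<Rightarrow> ennreal" where
  "hausdorff_gauge k A = (if A = {} then 0 else ennreal (diameter A ^ k))"

definition hausdorff_premeasure :: "nat \<Rightarrow> real \<Rightarrow> ('a::metric_space) set \<Rightarrow> ennreal" where
  "hausdorff_premeasure k \<delta> A =
     (INF U \<in> {U :: nat \<Rightarrow> 'a set. A \<subseteq> (\<Union>i. U i) \<and> (\<forall>i. bounded (U i) \<and> diameter (U i) \<le> \<delta>)}.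
        \<Sum>i. hausdorff_gauge k (U i))"

definition hausdorff_outer_measure :: "nat \<Rightarrow> ('a::metric_space) set \<Rightarrow> ennreal" where
  "hausdorff_outer_measure k A = (SUP \<delta>\<in>{0<..}. hausdorff_premeasure k \<delta> A)"

definition normalized_hausdorff_measure :: "nat \<Rightarrow> ('a::metric_space) set \<Rightarrow> 'a measure" where
  "normalized_hausdorff_measure k M =
     measure_of M (sets (restrict_space borel M))
       (\<lambda>A. hausdorff_outer_measure k A / hausdorff_outer_measure k M)"


section \<open>Samples\<close>

definition iid_sample :: "'w measure \<Rightarrow> 'a measure \<Rightarrow> nat \<Rightarrow> (nat \<Rightarrow> 'w \<Rightarrow> 'a) \<Rightarrow> bool" where
  "iid_sample \<Omega> \<mu> m X \<longleftrightarrow>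
     prob_space \<Omega> \<and> prob_space.indep_vars \<Omega> (\<lambda>_. \<mu>) X {..<m} \<and>
     (\<forall>i<m. distr \<Omega> \<mu> (X i) = \<mu>)"

definition sample_set :: "nat \<Rightarrow> (nat \<Rightarrow> 'w \<Rightarrow> 'a) \<Rightarrow> 'w \<Rightarrow> 'a set" where
  "sample_set m X \<omega> = (\<lambda>i. X i \<omega>) ` {..<m}"

end

theory Submission
  imports Defs
begin

text \<open>
  By stability it suffices to work up to a small error in the filtration values. If the sample \<open>P\<close> is
  \<open>\<delta>\<close>-dense in \<open>M\<close>, the distance functions to \<open>P\<close> and to \<open>M\<close> differ by at most \<open>\<delta>\<close>. The Cech
  filtration is the sublevel filtration of the (discontinuous) function on the full simplex on \<open>P\<close> that
  sends a point to the least radius admitting its support. Rounding the values of this function and of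
  the distance to \<open>P\<close> up to the next larger multiple of \<open>\<delta>\<close> turns sublevel sets at \<open>r\<close> into strict sublevel sets at
  \<open>\<delta> * \<lfloor>r / \<delta>\<rfloor>\<close>, so closed balls become open ones, and the nerve theorem for finitely many open
  convex sets becomes elementary: the space of pairs \<open>(y, a)\<close> with \<open>y\<close> in all balls of the support of
  \<open>a\<close> projects to the union and to the nerve, naturally in \<open>r\<close>, and both projections are homotopy
  equivalences.

  The sample becomes dense because every ball around a point of \<open>M\<close> has positive measure and finitely
  many balls of half the radius cover \<open>M\<close>.
\<close>

section \<open>Metrizable spaces and pointed homotopy equivalences\<close>

text \<open>All filtrations that occur are brought into the form of sublevel filtrations on
  metrizable spaces. There k-ification changes nothing and the CGWH conditions hold, so the topology
  of \<open>stable_distance\<close> becomes the ordinary one. Stability is assumed for arbitrary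
  functions; this admits both the discontinuous radius function on the simplex and the rounding.
  Rounding is needed because a continuous function that is positive exactly on a given set exists
  only if the set is open, and the section over the union is built from such functions. The distance
  \<open>d\<close> knows only spaces with points in one type \<open>'u\<close>, and injections are
  given for two point types. The space of pairs in the middle of the zigzag therefore has to be
  coded into \<open>'u\<close> as well. Error budget: \<open>\<delta>\<close> for rounding on the
  Cech side, \<open>\<delta>\<close> for rounding on the offset side, \<open>\<delta>\<close> for
  replacing \<open>M\<close> by the sample; the zigzag costs nothing. Smoothness of \<open>M\<close>
  enters only through the positivity of the Hausdorff measure of small pieces. Additivity and finite
  total mass come from the existence of a sample with this law.\<close>

definition transport_topology :: "('a \<Rightarrow> 'u) \<Rightarrow> 'a topology \<Rightarrow> 'u topology" where
  "transport_topology e X = pullback_topology (e ` topspace X) (inv e) X"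

lemma topspace_transport_topology:
  "inj e \<Longrightarrow> topspace (transport_topology e X) = e ` topspace X"
  by (auto simp: transport_topology_def topspace_pullback_topology)

lemma homeomorphic_maps_transport_topology:
  assumes "inj e"
  shows "homeomorphic_maps X (transport_topology e X) e (inv e)"
  unfolding homeomorphic_maps_def
proof (intro conjI)
  show "continuous_map X (transport_topology e X) e"
    unfolding transport_topology_def
    by (rule continuous_map_pullback') (use assms in \<open>auto simp: o_def\<close>)
  show "continuous_map (transport_topology e X) X (inv e)"
    unfolding transport_topology_def
    using continuous_map_pullback[of X X id "e ` topspace X" "inv e"] by simp
qed (use assms in \<open>auto simp: topspace_transport_topology\<close>)

lemma homeomorphic_space_transport_topology:
  "inj e \<Longrightarrow> X homeomorphic_space transport_topology e X"
  using homeomorphic_maps_transport_topology homeomorphic_space_def by blast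

text \<open>With \<open>P\<close> a sublevel condition, this says that taking sublevel sets commutes
  with transport, so a filtration keeps its form when moved into \<open>'u\<close>.\<close>

lemma subtopology_transport_topology:
  assumes "inj e"
  shows "subtopology (transport_topology e X) {u. P (inv e u)} = transport_topology e (subtopology X {x. P x})"
proof (rule topology_eq[THEN iffD2], intro allI)
  fix S
  show "openin (subtopology (transport_topology e X) {u. P (inv e u)}) S
     \<longleftrightarrow> openin (transport_topology e (subtopology X {x. P x})) S"
    unfolding openin_subtopology transport_topology_def openin_pullback_topology
  proof (intro iffI; elim exE conjE; clarify)
    fix U assume "openin X U"
    show "\<exists>Ua. (\<exists>T. openin X T \<and> Ua = T \<inter> {x. P x}) \<and>
            inv e -` U \<inter> e ` topspace X \<inter> {u. P (inv e u)} = inv e -` Ua \<inter> e ` topspace (subtopology X {x. P x})"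
      using \<open>openin X U\<close> assms by (intro exI[of _ "U \<inter> {x. P x}"]) auto
  next
    fix T assume "openin X T"
    show "\<exists>Ta. (\<exists>U. openin X U \<and> Ta = inv e -` U \<inter> e ` topspace X) \<and>
          inv e -` (T \<inter> {x. P x}) \<inter> e ` topspace (subtopology X {x. P x}) = Ta \<inter> {u. P (inv e u)}"
      using \<open>openin X T\<close> assms by (intro exI[of _ "inv e -` T \<inter> e ` topspace X"]) auto
  qed
qed

lemma metrizable_transport_topology:
  "inj e \<Longrightarrow> metrizable_space X \<Longrightarrow> metrizable_space (transport_topology e X)"
  using homeomorphic_metrizable_space homeomorphic_space_transport_topology by blast

section \<open>Metrizable spaces are compactly generated and weakly Hausdorff\<close>

lemma openin_imp_k_open: "openin X U \<Longrightarrow> k_open X U"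
  unfolding k_open_def by (auto simp: openin_subset openin_continuous_map_preimage)

text \<open>The topology of a metrizable space is determined by its compact subspaces. These are
  Hausdorff, and the double singletons \<open>{{x}}\<close> give each of them a copy among the test
  spaces of \<open>k_open\<close>.\<close>

lemma k_open_iff_openin:
  fixes X :: "'a topology"
  assumes "metrizable_space X"
  shows "k_open X U \<longleftrightarrow> openin X U"
proof
  assume U: "k_open X U"
  have *: "openin (subtopology X C) (C \<inter> U)" if C: "compactin X C" for C
  proof -
    define j :: "'a \<Rightarrow> 'a set set" where "j x = {{x}}" for x
    define K where "K = transport_topology j (subtopology X C)"
    have j: "inj j"
      by (auto simp: j_def inj_def)
    have hom: "homeomorphic_maps (subtopology X C) K j (inv j)"
      unfolding K_def by (rule homeomorphic_maps_transport_topology[OF j])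
    have "subtopology X C homeomorphic_space K"
      using hom homeomorphic_space_def by blast
    moreover have "compact_space (subtopology X C)" "Hausdorff_space (subtopology X C)"
      using C metrizable_imp_Hausdorff_space[OF assms]
      by (auto simp: compact_space_subtopology Hausdorff_space_subtopology)
    ultimately have "compact_space K" "Hausdorff_space K"
      using homeomorphic_compact_space homeomorphic_Hausdorff_space by blast+
    moreover have "continuous_map K X (inv j)"
      using hom by (auto simp: homeomorphic_maps_def continuous_map_in_subtopology)
    ultimately have "openin K {x \<in> topspace K. inv j x \<in> U}"
      using U unfolding k_open_def by blast
    then have "openin (subtopology X C) {x \<in> topspace (subtopology X C). j x \<in> {x \<in> topspace K. inv j x \<in> U}}"
      using hom openin_continuous_map_preimage unfolding homeomorphic_maps_def by blast
    moreover have "{x \<in> topspace (subtopology X C). j x \<in> {x \<in> topspace K. inv j x \<in> U}} = C \<inter> U"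
      using j compactin_subset_topspace[OF C] U
      unfolding K_def topspace_transport_topology[OF j] k_open_def by auto
    ultimately show ?thesis by simp
  qed
  show "openin X U"
    using metrizable_imp_k_space[OF assms] * U unfolding k_space_open k_open_def by blast
qed (rule openin_imp_k_open)

lemma cg_ification_metrizable: "metrizable_space X \<Longrightarrow> cg_ification X = X"
  by (simp add: topology_eq openin_cg_ification k_open_iff_openin)

lemma CGWH_metrizable:
  fixes X :: "'a topology"
  assumes "metrizable_space X"
  shows "CGWH X"
proof -
  have "closedin X (u ` topspace K)"
    if "compact_space K" "continuous_map K X u" for K :: "'a set set topology" and u
    using that metrizable_imp_Hausdorff_space[OF assms]
    by (intro compactin_imp_closedin) (auto simp: compact_space_def intro: image_compactin)
  then show ?thesis
    unfolding CGWH_def compactly_generated_space_def weakly_Hausdorff_space_def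
    using k_open_iff_openin[OF assms] by blast
qed

text \<open>The homotopy inverse may depend on the base point. This makes the homotopies relative to the base
  point, so that no change of base point is needed in the comparison of homotopy groups.\<close>

definition pointed_homotopy_equivalence :: "'a topology \<Rightarrow> 'b topology \<Rightarrow> ('a \<Rightarrow> 'b) \<Rightarrow> bool" where
  "pointed_homotopy_equivalence X Y f \<longleftrightarrow>
     continuous_map X Y f \<and> (topspace X = {} \<longrightarrow> topspace Y = {}) \<and>
     (\<forall>x\<in>topspace X. \<exists>g. continuous_map Y X g \<and> g (f x) = x \<and>
        homotopic_with (\<lambda>q. q x = x) X X (g \<circ> f) id \<and>
        homotopic_with (\<lambda>q. q (f x) = f x) Y Y (f \<circ> g) id)"

lemma pointed_homotopy_equivalence_homeomorphic:
  assumes "homeomorphic_maps X Y f g"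
  shows "pointed_homotopy_equivalence X Y f"
  unfolding pointed_homotopy_equivalence_def
proof (intro conjI ballI impI exI)
  have fg: "continuous_map X Y f" "continuous_map Y X g"
    "\<And>x. x \<in> topspace X \<Longrightarrow> g (f x) = x" "\<And>y. y \<in> topspace Y \<Longrightarrow> f (g y) = y"
    using assms by (auto simp: homeomorphic_maps_def)
  show "continuous_map X Y f" by fact
  show "topspace Y = {}" if "topspace X = {}"
    using continuous_map_image_subset_topspace[OF fg(2)] that by blast
  fix x assume x: "x \<in> topspace X"
  show "continuous_map Y X g" "g (f x) = x" using fg x by auto
  show "homotopic_with (\<lambda>q. q x = x) X X (g \<circ> f) id"
    using fg x by (intro homotopic_with_equal) (auto intro: continuous_map_compose)
  show "homotopic_with (\<lambda>q. q (f x) = f x) Y Y (f \<circ> g) id"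
    using fg x by (intro homotopic_with_equal) (auto intro: continuous_map_compose)
qed

lemma pointed_homotopy_equivalence_compose:
  assumes 1: "pointed_homotopy_equivalence X Y f" and 2: "pointed_homotopy_equivalence Y Z f'"
  shows "pointed_homotopy_equivalence X Z (f' \<circ> f)"
  unfolding pointed_homotopy_equivalence_def
proof (intro conjI ballI impI)
  have f: "continuous_map X Y f" and f': "continuous_map Y Z f'"
    using 1 2 by (auto simp: pointed_homotopy_equivalence_def)
  show "continuous_map X Z (f' \<circ> f)" using f f' by (rule continuous_map_compose)
  show "topspace X = {} \<Longrightarrow> topspace Z = {}"
    using 1 2 by (auto simp: pointed_homotopy_equivalence_def)
  fix x assume x: "x \<in> topspace X"
  then have y: "f x \<in> topspace Y" using f by (auto simp: continuous_map_def)
  obtain g where g: "continuous_map Y X g" "g (f x) = x"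
      "homotopic_with (\<lambda>q. q x = x) X X (g \<circ> f) id"
      "homotopic_with (\<lambda>q. q (f x) = f x) Y Y (f \<circ> g) id"
    using 1 x unfolding pointed_homotopy_equivalence_def by blast
  \<comment> \<open>Taken at the base point \<open>f x\<close>: the composite of the two inverses
    then returns \<open>f' (f x)\<close> to \<open>x\<close>, and both composed homotopies fix the
    base points.\<close>
  obtain g' where g': "continuous_map Z Y g'" "g' (f' (f x)) = f x"
      "homotopic_with (\<lambda>q. q (f x) = f x) Y Y (g' \<circ> f') id"
      "homotopic_with (\<lambda>q. q (f' (f x)) = f' (f x)) Z Z (f' \<circ> g') id"
    using 2 y unfolding pointed_homotopy_equivalence_def by blast
  have "homotopic_with (\<lambda>q. q (f x) = x) Y X (g \<circ> (g' \<circ> f')) (g \<circ> id)"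
    by (rule homotopic_with_compose_continuous_map_left[OF g'(3) g(1)]) (simp add: g)
  then have "homotopic_with (\<lambda>q. q x = x) X X ((g \<circ> (g' \<circ> f')) \<circ> f) ((g \<circ> id) \<circ> f)"
    by (rule homotopic_with_compose_continuous_map_right[OF _ f]) simp
  then have A: "homotopic_with (\<lambda>q. q x = x) X X ((g \<circ> g') \<circ> (f' \<circ> f)) id"
    using g(3) by (auto simp: o_assoc intro: homotopic_with_trans)
  have "homotopic_with (\<lambda>q. q (f x) = f' (f x)) Y Z (f' \<circ> (f \<circ> g)) (f' \<circ> id)"
    by (rule homotopic_with_compose_continuous_map_left[OF g(4) f']) simp
  then have "homotopic_with (\<lambda>q. q (f' (f x)) = f' (f x)) Z Z ((f' \<circ> (f \<circ> g)) \<circ> g') ((f' \<circ> id) \<circ> g')"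
    by (rule homotopic_with_compose_continuous_map_right[OF _ g'(1)]) (simp add: g')
  then have B: "homotopic_with (\<lambda>q. q (f' (f x)) = f' (f x)) Z Z ((f' \<circ> f) \<circ> (g \<circ> g')) id"
    using g'(4) by (auto simp: o_assoc intro: homotopic_with_trans)
  show "\<exists>h. continuous_map Z X h \<and> h ((f' \<circ> f) x) = x \<and>
        homotopic_with (\<lambda>q. q x = x) X X (h \<circ> (f' \<circ> f)) id \<and>
        homotopic_with (\<lambda>q. q ((f' \<circ> f) x) = (f' \<circ> f) x) Z Z (f' \<circ> f \<circ> h) id"
    using A B g g' continuous_map_compose[OF g'(1) g(1)] by (intro exI[of _ "g \<circ> g'"]) auto
qed

section \<open>Homotopy groups and path components under pointed homotopy equivalences\<close>

lemma equiv_loop_homotopy: "equiv (loops n X x) (loop_homotopy n X x)"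
proof (rule equivI)
  show "loop_homotopy n X x \<subseteq> loops n X x \<times> loops n X x"
  proof clarify
    fix g h assume "(g, h) \<in> loop_homotopy n X x"
    then have "homotopic_with (\<lambda>q. \<forall>t\<in>cube_boundary n. q t = x) (top_of_set (cube n)) X g h"
      by (simp add: loop_homotopy_def)
    from homotopic_with_imp_continuous_maps[OF this] homotopic_with_imp_property[OF this]
    show "g \<in> loops n X x \<and> h \<in> loops n X x"
      by (simp add: loops_def)
  qed
  show "refl_on (loops n X x) (loop_homotopy n X x)"
    by (auto simp: refl_on_def loop_homotopy_def loops_def)
  show "sym (loop_homotopy n X x)"
    unfolding loop_homotopy_def by (intro symI) (simp add: homotopic_with_sym)
  show "trans (loop_homotopy n X x)"
    unfolding loop_homotopy_def by (intro transI) (simp, rule homotopic_with_trans)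
qed

lemma loops_compose:
  assumes "l \<in> loops n X x" "continuous_map X Y f"
  shows "f \<circ> l \<in> loops n Y (f x)"
  using assms continuous_map_compose[of _ X l Y f] unfolding loops_def by auto

lemma loop_homotopy_compose:
  assumes "(l, l') \<in> loop_homotopy n X x" "continuous_map X Y f"
  shows "(f \<circ> l, f \<circ> l') \<in> loop_homotopy n Y (f x)"
  using assms unfolding loop_homotopy_def
  by (auto intro: homotopic_with_compose_continuous_map_left)

text \<open>Precompose the homotopy with \<open>l\<close>: the cube boundary sits at
  \<open>x\<close>, which never moves, so the result is a homotopy of pairs.\<close>

lemma loop_homotopy_compose_pointed_id:
  assumes l: "l \<in> loops n X x" and h: "homotopic_with (\<lambda>q. q x = x) X X h id"
  shows "(h \<circ> l, l) \<in> loop_homotopy n X x"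
proof -
  have "homotopic_with (\<lambda>q. \<forall>t\<in>cube_boundary n. q t = x) (top_of_set (cube n)) X (h \<circ> l) (id \<circ> l)"
    by (rule homotopic_with_compose_continuous_map_right[OF h]) (use l in \<open>auto simp: loops_def\<close>)
  then show ?thesis by (simp add: loop_homotopy_def)
qed

text \<open>Independence of the representative; it allows the bijectivity proof to work with loops
  instead of classes.\<close>

lemma homotopy_group_map_class:
  assumes l: "l \<in> loops n X x" and f: "continuous_map X Y f"
  shows "homotopy_group_map n Y f x (loop_homotopy n X x `` {l}) = loop_homotopy n Y (f x) `` {f \<circ> l}"
proof -
  have E: "equiv (loops n Y (f x)) (loop_homotopy n Y (f x))" by (rule equiv_loop_homotopy)
  have "(l, l) \<in> loop_homotopy n X x"
    using equiv_class_self[OF equiv_loop_homotopy l] by simp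
  show ?thesis
    unfolding homotopy_group_map_def
  proof (intro equalityI subsetI)
    fix k assume "k \<in> loop_homotopy n Y (f x) `` ((\<circ>) f ` loop_homotopy n X x `` {l})"
    then obtain l' where l': "(l, l') \<in> loop_homotopy n X x" "(f \<circ> l', k) \<in> loop_homotopy n Y (f x)"
      by blast
    show "k \<in> loop_homotopy n Y (f x) `` {f \<circ> l}"
      using loop_homotopy_compose[OF l'(1) f] l'(2) E unfolding equiv_def by (meson Image_singleton_iff transE)
  qed (use \<open>(l, l) \<in> loop_homotopy n X x\<close> in blast)
qed

text \<open>The inverse belonging to the base point \<open>x\<close> induces a two-sided inverse on
  classes of loops at \<open>x\<close>. On path components any of these inverses will do, since a
  homotopy to the identity moves each point along a path.\<close>

lemma weak_homotopy_equivalence_pointed: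
  assumes "pointed_homotopy_equivalence X Y f"
  shows "weak_homotopy_equivalence X Y f"
  unfolding weak_homotopy_equivalence_def
proof (intro conjI allI impI ballI)
  show f: "continuous_map X Y f"
    using assms by (simp add: pointed_homotopy_equivalence_def)
  have inv: "\<exists>g. continuous_map Y X g \<and> g (f x) = x \<and>
        homotopic_with (\<lambda>q. q x = x) X X (g \<circ> f) id \<and>
        homotopic_with (\<lambda>q. q (f x) = f x) Y Y (f \<circ> g) id" if "x \<in> topspace X" for x
    using assms that unfolding pointed_homotopy_equivalence_def by blast
  have fX: "f x \<in> topspace Y" if "x \<in> topspace X" for x
    using f that by (auto simp: continuous_map_def)
  have path_image: "path_component_of B (h x) (h y)"
    if "continuous_map A B h" "path_component_of A x y"
    for h x y and A :: "'c topology" and B :: "'d topology"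
    using that unfolding path_component_of_def
    by (metis comp_apply pathin_compose)
  have path_hom: "path_component_of A (h x) x"
    if hom: "homotopic_with P A A h id" and x: "x \<in> topspace A" for P h x and A :: "'c topology"
  proof -
    obtain k where k: "continuous_map (prod_topology (top_of_set {0..1::real}) A) A k"
      "\<And>x. k (0, x) = h x" "\<And>x. k (1, x) = x"
      using hom unfolding homotopic_with_def by auto
    have "pathin A (\<lambda>t. k (t, x))"
      unfolding pathin_def using x
      by (intro continuous_map_compose[OF _ k(1), unfolded o_def]) (auto intro!: continuous_intros)
    then show ?thesis
      unfolding path_component_of_def using k by (intro exI[of _ "\<lambda>t. k (t, x)"]) auto
  qed
  have comp_map: "path_components_map Y f (path_component_of_set X x) = path_component_of_set Y (f x)"
    if "x \<in> topspace X" for x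
    unfolding path_components_map_def
  proof (intro equalityI subsetI)
    fix y assume "y \<in> (\<Union>c\<in>path_component_of_set X x. path_component_of_set Y (f c))"
    then show "y \<in> path_component_of_set Y (f x)"
      using path_image[OF f] path_component_of_trans by fastforce
  next
    fix y assume "y \<in> path_component_of_set Y (f x)"
    then show "y \<in> (\<Union>c\<in>path_component_of_set X x. path_component_of_set Y (f c))"
      using that path_component_of_refl by fastforce
  qed
  show "bij_betw (path_components_map Y f) (path_components_of X) (path_components_of Y)"
    unfolding bij_betw_def
  proof
    show "inj_on (path_components_map Y f) (path_components_of X)"
    proof (rule inj_onI)
      fix C D assume CD: "C \<in> path_components_of X" "D \<in> path_components_of X"
        and eq: "path_components_map Y f C = path_components_map Y f D"
      obtain c d where c: "c \<in> topspace X" "C = path_component_of_set X c"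
        and d: "d \<in> topspace X" "D = path_component_of_set X d"
        using CD unfolding path_components_of_def by blast
      obtain g where g: "continuous_map Y X g" "homotopic_with (\<lambda>q. q c = c) X X (g \<circ> f) id"
        using inv[OF c(1)] by blast
      have "path_component_of Y (f c) (f d)"
        using eq comp_map c d fX path_component_of_refl by (metis mem_Collect_eq)
      then have "path_component_of X (g (f c)) (g (f d))"
        by (rule path_image[OF g(1)])
      moreover have "path_component_of X (g (f c)) c" "path_component_of X (g (f d)) d"
        using path_hom[OF g(2)] c d by auto
      ultimately have "path_component_of X c d"
        by (meson path_component_of_sym path_component_of_trans)
      then show "C = D"
        using c d by (metis path_component_of_eq)
    qed
    show "path_components_map Y f ` path_components_of X = path_components_of Y"
    proof (intro equalityI subsetI)
      fix D assume "D \<in> path_components_map Y f ` path_components_of X"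
      then show "D \<in> path_components_of Y"
        unfolding path_components_of_def using comp_map fX by auto
    next
      fix D assume "D \<in> path_components_of Y"
      then obtain y where y: "y \<in> topspace Y" "D = path_component_of_set Y y"
        unfolding path_components_of_def by blast
      \<comment> \<open>An inverse is available only after a base point has been chosen. The clause
        on empty spaces in \<open>pointed_homotopy_equivalence\<close> provides one.\<close>
      then obtain x where x: "x \<in> topspace X"
        using assms unfolding pointed_homotopy_equivalence_def by blast
      obtain g where g: "continuous_map Y X g" "homotopic_with (\<lambda>q. q (f x) = f x) Y Y (f \<circ> g) id"
        using inv[OF x] by blast
      have gy: "g y \<in> topspace X"
        using g(1) y by (auto simp: continuous_map_def)
      have "path_component_of Y (f (g y)) y"
        using path_hom[OF g(2) y(1)] by simp
      then have "D = path_components_map Y f (path_component_of_set X (g y))"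
        unfolding comp_map[OF gy] y(2) using fX[OF gy] y(1) by (metis path_component_of_eq)
      then show "D \<in> path_components_map Y f ` path_components_of X"
        unfolding path_components_of_def using gy by blast
    qed
  qed
  fix n x assume x: "x \<in> topspace X"
  obtain g where g: "continuous_map Y X g" "g (f x) = x"
      "homotopic_with (\<lambda>q. q x = x) X X (g \<circ> f) id"
      "homotopic_with (\<lambda>q. q (f x) = f x) Y Y (f \<circ> g) id"
    using inv[OF x] by blast
  have EX: "equiv (loops n X x) (loop_homotopy n X x)"
    and EY: "equiv (loops n Y (f x)) (loop_homotopy n Y (f x))" by (rule equiv_loop_homotopy)+
  show "bij_betw (homotopy_group_map n Y f x) (homotopy_group n X x) (homotopy_group n Y (f x))"
    unfolding bij_betw_def
  proof
    show "inj_on (homotopy_group_map n Y f x) (homotopy_group n X x)"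
    proof (rule inj_onI)
      fix c d assume cd: "c \<in> homotopy_group n X x" "d \<in> homotopy_group n X x"
        and eq: "homotopy_group_map n Y f x c = homotopy_group_map n Y f x d"
      obtain l l' where l: "l \<in> loops n X x" "c = loop_homotopy n X x `` {l}"
        and l': "l' \<in> loops n X x" "d = loop_homotopy n X x `` {l'}"
        using cd unfolding homotopy_group_def by (auto elim!: quotientE)
      have "(f \<circ> l, f \<circ> l') \<in> loop_homotopy n Y (f x)"
        using eq unfolding l(2) l'(2) homotopy_group_map_class[OF l(1) f] homotopy_group_map_class[OF l'(1) f]
        using eq_equiv_class[OF _ EY] loops_compose[OF l'(1) f] by blast
      then have "(g \<circ> (f \<circ> l), g \<circ> (f \<circ> l')) \<in> loop_homotopy n X x"
        using loop_homotopy_compose[OF _ g(1)] g(2) by metis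
      moreover have "((g \<circ> f) \<circ> l, l) \<in> loop_homotopy n X x" "((g \<circ> f) \<circ> l', l') \<in> loop_homotopy n X x"
        using loop_homotopy_compose_pointed_id[OF _ g(3)] l l' by blast+
      ultimately have "(l, l') \<in> loop_homotopy n X x"
        using EX unfolding equiv_def o_assoc by (meson symE transE)
      then show "c = d"
        unfolding l l' by (rule equiv_class_eq[OF EX])
    qed
    show "homotopy_group_map n Y f x ` homotopy_group n X x = homotopy_group n Y (f x)"
    proof (intro equalityI subsetI)
      fix d assume "d \<in> homotopy_group_map n Y f x ` homotopy_group n X x"
      then obtain l where l: "l \<in> loops n X x" "d = homotopy_group_map n Y f x (loop_homotopy n X x `` {l})"
        unfolding homotopy_group_def by (auto elim!: quotientE)
      show "d \<in> homotopy_group n Y (f x)"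
        unfolding l(2) homotopy_group_map_class[OF l(1) f] homotopy_group_def
        by (intro quotientI loops_compose[OF l(1) f])
    next
      fix d assume "d \<in> homotopy_group n Y (f x)"
      then obtain m where m: "m \<in> loops n Y (f x)" "d = loop_homotopy n Y (f x) `` {m}"
        unfolding homotopy_group_def by (auto elim!: quotientE)
      have gm: "g \<circ> m \<in> loops n X x"
        using loops_compose[OF m(1) g(1)] g(2) by simp
      have "((f \<circ> g) \<circ> m, m) \<in> loop_homotopy n Y (f x)"
        by (rule loop_homotopy_compose_pointed_id[OF m(1) g(4)])
      then have "d = homotopy_group_map n Y f x (loop_homotopy n X x `` {g \<circ> m})"
        unfolding m(2) homotopy_group_map_class[OF gm f] o_assoc
        using equiv_class_eq[OF EY] by metis
      then show "d \<in> homotopy_group_map n Y f x ` homotopy_group n X x"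
        unfolding homotopy_group_def using gm by (auto intro: quotientI)
    qed
  qed
qed

section \<open>The nerve of a finite open convex cover\<close>

lemma homotopic_with_pointed_on:
  fixes S :: "'a::topological_space set" and T :: "'b::topological_space set"
    and h :: "real \<times> 'a \<Rightarrow> 'b"
  assumes "continuous_on ({0..1} \<times> S) h" "\<And>t x. t \<in> {0..1} \<Longrightarrow> x \<in> S \<Longrightarrow> h (t, x) \<in> T"
    and "\<And>x. x \<in> S \<Longrightarrow> h (0, x) = p x" "\<And>x. x \<in> S \<Longrightarrow> h (1, x) = q x"
    and "x0 \<in> S" "\<And>t. t \<in> {0..1} \<Longrightarrow> h (t, x0) = y0"
  shows "homotopic_with (\<lambda>q. q x0 = y0) (top_of_set S) (top_of_set T) p q"
proof (rule homotopic_with[THEN iffD2])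
  have "continuous_map (prod_topology (top_of_set {0..1}) (top_of_set S)) (top_of_set T) h"
    using assms(1,2) by (simp flip: subtopology_Times) (auto simp: continuous_map_in_subtopology)
  then show "\<exists>h :: real \<times> 'a \<Rightarrow> 'b. continuous_map (prod_topology (top_of_set {0..1}) (top_of_set S)) (top_of_set T) h \<and>
        (\<forall>x\<in>topspace (top_of_set S). h (0, x) = p x) \<and> (\<forall>x\<in>topspace (top_of_set S). h (1, x) = q x) \<and>
        (\<forall>t\<in>{0..1}. h (t, x0) = y0)"
    using assms(3-6) by - (rule exI[of _ h], intro conjI ballI, simp_all)
qed (use assms in auto)

section \<open>Simplices and the blow-up of a cover\<close>

lemma closed_simplex_nonneg: "a \<in> closed_simplex I \<Longrightarrow> 0 \<le> a i"
  and closed_simplex_support: "a \<in> closed_simplex I \<Longrightarrow> a i \<noteq> 0 \<Longrightarrow> i \<in> I"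
  and closed_simplex_sum: "a \<in> closed_simplex I \<Longrightarrow> sum a I = 1"
  by (auto simp: closed_simplex_def)

lemma closed_simplex_nonzero:
  assumes "a \<in> closed_simplex I"
  obtains i where "i \<in> I" "a i \<noteq> 0"
  by (rule sum.not_neutral_contains_not_neutral[of a I]) (use closed_simplex_sum[OF assms] in auto)

lemma closed_simplex_interpolation:
  assumes "a \<in> closed_simplex I" "b \<in> closed_simplex I" "t \<in> {0..1}"
  shows "(\<lambda>i. (1 - t) * a i + t * b i) \<in> closed_simplex I"
proof -
  have "i \<in> I" if "(1 - t) * a i + t * b i \<noteq> 0" for i
    using that closed_simplex_support[OF assms(1), of i] closed_simplex_support[OF assms(2), of i] by force
  then show ?thesis
    using assms by (auto simp: closed_simplex_def sum.distrib simp flip: sum_distrib_left)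
qed

text \<open>Supports are finite because \<open>I\<close> is, and nonempty because the coordinates
  sum to 1. Of the conditions on a simplex only the common point remains.\<close>

lemma realization_points_nerve:
  assumes I: "finite I"
  shows "realization_points (nerve I B) = {a \<in> closed_simplex I. \<exists>y. \<forall>i. a i \<noteq> 0 \<longrightarrow> y \<in> B i}"
proof -
  have sum: "(\<Sum>i | a i \<noteq> 0. a i) = sum a I" if "{i. a i \<noteq> 0} \<subseteq> I" for a :: "'a \<Rightarrow> real"
    using that by (intro sum.mono_neutral_left) (auto simp: I)
  have "{i. a i \<noteq> 0} \<noteq> {}" if "a \<in> closed_simplex I" for a
    using closed_simplex_nonzero[OF that] by blast
  moreover have "finite {i. a i \<noteq> 0}" if "a \<in> closed_simplex I" for a
    using I that by (auto simp: closed_simplex_def intro: finite_subset)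
  ultimately show ?thesis
    using sum by (auto simp: realization_points_def nerve_def closed_simplex_def)
qed

text \<open>The Mayer-Vietoris blow-up of the cover. The fibre over \<open>y\<close> is the full
  simplex on the indices of the sets containing \<open>y\<close>; the fibre over \<open>a\<close> is
  the intersection of the sets in the support of \<open>a\<close>.\<close>

definition nerve_total :: "'i set \<Rightarrow> ('i \<Rightarrow> 'a set) \<Rightarrow> ('a \<times> ('i \<Rightarrow> real)) set" where
  "nerve_total I B = {(y, a). a \<in> closed_simplex I \<and> (\<forall>i. a i \<noteq> 0 \<longrightarrow> y \<in> B i)}"

text \<open>The distance to the complement has this property. The whole space is treated apart
  because \<open>infdist\<close> to the empty set is 0.\<close>

lemma open_positive_function:
  fixes U :: "'a::metric_space set"
  assumes "open U"
  shows "\<exists>u :: 'a \<Rightarrow> real. continuous_on UNIV u \<and> (\<forall>y. 0 \<le> u y) \<and> (\<forall>y. 0 < u y \<longleftrightarrow> y \<in> U)"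
proof (cases "U = UNIV")
  case True
  then show ?thesis by (intro exI[of _ "\<lambda>_. 1"]) auto
next
  case False
  have "0 < infdist y (- U) \<longleftrightarrow> y \<in> U" for y
    using assms False in_closed_iff_infdist_zero[of "- U" y] infdist_nonneg[of y "- U"]
    by (auto simp: less_le)
  then show ?thesis
    by (intro exI[of _ "\<lambda>y. infdist y (- U)"]) (auto intro!: continuous_intros infdist_nonneg)
qed

text \<open>A partition of unity subordinate to the cover is a section of \<open>fst\<close>, and
  the fibres are convex, so the blow-up deforms onto the section linearly. To pass through the base
  point, the partition of unity is blended with the constant \<open>a0\<close> near
  \<open>y0\<close>.\<close>

lemma pointed_homotopy_equivalence_nerve_total_fst:
  fixes B :: "'i \<Rightarrow> 'a::metric_space set"
  assumes I: "finite I" and B: "\<And>i. i \<in> I \<Longrightarrow> open (B i)"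
  shows "pointed_homotopy_equivalence (top_of_set (nerve_total I B)) (top_of_set (\<Union>i\<in>I. B i)) fst"
    (is "pointed_homotopy_equivalence (top_of_set ?Z) (top_of_set ?O) fst")
  unfolding pointed_homotopy_equivalence_def
proof (intro conjI ballI impI)
  have fst_in: "fst z \<in> ?O" if zZ: "z \<in> ?Z" for z
  proof -
    obtain y a where z: "z = (y, a)" "a \<in> closed_simplex I" "\<forall>i. a i \<noteq> 0 \<longrightarrow> y \<in> B i"
      using zZ by (auto simp: nerve_total_def)
    have "\<exists>i\<in>I. a i \<noteq> 0"
      using closed_simplex_nonzero[OF z(2)] by blast
    then show ?thesis using z by auto
  qed
  show cont_fst: "continuous_map (top_of_set ?Z) (top_of_set ?O) fst"
    using fst_in by (auto simp: continuous_map_in_subtopology intro!: continuous_intros)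
  show "topspace (top_of_set ?O) = {}" if "topspace (top_of_set ?Z) = {}"
  proof (rule ccontr)
    assume "topspace (top_of_set ?O) \<noteq> {}"
    then obtain i y where "i \<in> I" "y \<in> B i" by auto
    then have "(y, \<lambda>j. if j = i then 1 else 0) \<in> ?Z"
      using I by (auto simp: nerve_total_def closed_simplex_def)
    then show False using that by simp
  qed
  fix z0 assume "z0 \<in> topspace (top_of_set ?Z)"
  then obtain y0 a0 where z0: "z0 = (y0, a0)" "a0 \<in> closed_simplex I" "\<And>i. a0 i \<noteq> 0 \<Longrightarrow> y0 \<in> B i"
    by (auto simp: nerve_total_def)
  have z0_in: "z0 \<in> ?Z"
    using \<open>z0 \<in> topspace (top_of_set ?Z)\<close> by simp
  \<comment> \<open>The neighbourhood of \<open>y0\<close> on which \<open>a0\<close> is still an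
    admissible coordinate vector.\<close>
  define D where "D = (\<Inter>i\<in>{i \<in> I. a0 i \<noteq> 0}. B i)"
  have "open D" unfolding D_def using I B by (intro open_INT) auto
  then obtain uD :: "'a \<Rightarrow> real" where uD: "continuous_on UNIV uD" "\<And>y. 0 \<le> uD y" "\<And>y. 0 < uD y \<longleftrightarrow> y \<in> D"
    using open_positive_function[OF \<open>open D\<close>] by blast
  have "\<exists>u :: 'a \<Rightarrow> real. continuous_on UNIV u \<and> (\<forall>y. 0 \<le> u y) \<and> (\<forall>y. 0 < u y \<longleftrightarrow> y \<in> B i)" if "i \<in> I" for i
    using open_positive_function[OF B[OF that]] .
  then obtain u :: "'i \<Rightarrow> 'a \<Rightarrow> real" where u: "\<And>i. i \<in> I \<Longrightarrow> continuous_on UNIV (u i)"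
      "\<And>i y. i \<in> I \<Longrightarrow> 0 \<le> u i y" "\<And>i y. i \<in> I \<Longrightarrow> 0 < u i y \<longleftrightarrow> y \<in> B i"
    by metis
  have y0D: "0 < uD y0" using uD z0 by (auto simp: D_def)
  \<comment> \<open>The blending weight: 1 at \<open>y0\<close>, so that the section takes the value
    \<open>a0\<close> there, and 0 off \<open>D\<close>, where \<open>a0\<close> may be
    inadmissible.\<close>
  define w where "w y = min 1 (uD y / uD y0)" for y
  have w_cont: "continuous_on UNIV w"
    unfolding w_def using uD(1) y0D by (intro continuous_intros) auto
  have w: "0 \<le> w y" "w y \<le> 1" "w y0 = 1" "y \<notin> D \<Longrightarrow> w y = 0" for y
    using uD(2)[of y] uD(3)[of y] y0D by (auto simp: w_def)
  define U where "U y = (\<Sum>i\<in>I. u i y)" for y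
  have U: "0 < U y" if "y \<in> ?O" for y
    unfolding U_def using that u I by (auto intro!: sum_pos2)
  have contU: "continuous_on S U" "i \<in> I \<Longrightarrow> continuous_on S (u i)" "continuous_on S w" for S i
    unfolding U_def using u(1) w_cont by (auto intro!: continuous_intros intro: continuous_on_subset)
  define s where "s y i = (1 - w y) * (if i \<in> I then u i y / U y else 0) + w y * a0 i" for y i
  have s_cont: "continuous_on ?O (\<lambda>y. s y i)" for i
    unfolding s_def using contU U by (cases "i \<in> I") (force intro!: continuous_intros)+
  have s_simplex: "s y \<in> closed_simplex I" if "y \<in> ?O" for y
  proof -
    have "(\<lambda>i. if i \<in> I then u i y / U y else 0) \<in> closed_simplex I"
      using U[OF that] u by (auto simp: closed_simplex_def U_def simp flip: sum_divide_distrib)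
    from closed_simplex_interpolation[OF this z0(2), of "w y"] show ?thesis
      unfolding s_def using w by auto
  qed
  have s_supp: "y \<in> B i" if y: "y \<in> ?O" and si: "s y i \<noteq> 0" for y i
  proof -
    have i: "i \<in> I" using closed_simplex_support[OF s_simplex[OF y] si] .
    show ?thesis
    proof (rule ccontr)
      assume n: "y \<notin> B i"
      then have "u i y = 0" using u[OF i] by (metis less_le)
      moreover have "w y * a0 i = 0"
        using w(4)[of y] n i by (auto simp: D_def)
      ultimately show False using si i unfolding s_def by simp
    qed
  qed
  have s0: "s y0 = a0" by (rule ext) (simp add: s_def w)
  define g where "g y = (y, s y)" for y
  have contg: "continuous_map (top_of_set ?O) (top_of_set ?Z) g"
    using s_cont s_simplex s_supp unfolding g_def
    by (auto simp: continuous_map_in_subtopology nerve_total_def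
        intro!: continuous_intros continuous_on_coordinatewise_then_product)
  have "homotopic_with (\<lambda>q. q z0 = z0) (top_of_set ?Z) (top_of_set ?Z) (g \<circ> fst) id"
  proof (rule homotopic_with_pointed_on[where h = "\<lambda>(t, (y, a)). (y, \<lambda>i. (1 - t) * s y i + t * a i)"])
    have [continuous_intros]: "continuous_on ({0..1::real} \<times> ?Z) (\<lambda>x. s (fst (snd x)) i)" for i
      by (rule continuous_on_compose2[OF s_cont]) (use fst_in in \<open>auto intro!: continuous_intros\<close>)
    have [continuous_intros]: "continuous_on ({0..1::real} \<times> ?Z) (\<lambda>x. snd (snd x) i)" for i
      by (rule continuous_on_product_then_coordinatewise) (intro continuous_on_snd continuous_on_id)
    show "continuous_on ({0..1} \<times> ?Z) (\<lambda>(t, (y, a)). (y, \<lambda>i. (1 - t) * s y i + t * a i))"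
      unfolding split_beta
      by (intro continuous_intros continuous_on_coordinatewise_then_product)
    fix t :: real and z assume t: "t \<in> {0..1}" and z: "z \<in> ?Z"
    obtain y a where ya: "z = (y, a)" "a \<in> closed_simplex I" "\<And>i. a i \<noteq> 0 \<Longrightarrow> y \<in> B i"
      using z by (auto simp: nerve_total_def)
    have y: "y \<in> ?O" using fst_in[OF z] ya by simp
    have "y \<in> B i" if "(1 - t) * s y i + t * a i \<noteq> 0" for i
      using that ya(3)[of i] s_supp[OF y, of i] by fastforce
    then show "(case (t, z) of (t, y, a) \<Rightarrow> (y, \<lambda>i. (1 - t) * s y i + t * a i)) \<in> ?Z"
      using ya(1) closed_simplex_interpolation[OF s_simplex[OF y] ya(2) t] by (auto simp: nerve_total_def)
  qed (auto simp: z0 s0 g_def z0_in[unfolded z0] algebra_simps)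
  \<comment> \<open>\<open>fst \<circ> g\<close> is the identity on the nose, so a constant homotopy
    suffices.\<close>
  moreover have "homotopic_with (\<lambda>q. q (fst z0) = fst z0) (top_of_set ?O) (top_of_set ?O) (fst \<circ> g) id"
    using continuous_map_compose[OF contg cont_fst] by (intro homotopic_with_equal) (auto simp: g_def)
  ultimately show "\<exists>g. continuous_map (top_of_set ?O) (top_of_set ?Z) g \<and> g (fst z0) = z0 \<and>
      homotopic_with (\<lambda>q. q z0 = z0) (top_of_set ?Z) (top_of_set ?Z) (g \<circ> fst) id \<and>
      homotopic_with (\<lambda>q. q (fst z0) = fst z0) (top_of_set ?O) (top_of_set ?O) (fst \<circ> g) id"
    using contg by (intro exI[of _ g]) (auto simp: g_def z0 s0)
qed

text \<open>The inverse sends \<open>a\<close> to \<open>(y a, r a)\<close>. Cutting off coordinates at \<open>c\<close> makes the support of \<open>r a\<close>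
  smaller; the weight \<open>W \<sigma> a\<close> of the chosen point \<open>Y \<sigma>\<close> vanishes unless \<open>\<sigma>\<close> lies between the supports of
  \<open>r a\<close> and \<open>a\<close>, so \<open>y a\<close> is in all sets belonging to \<open>r a\<close>. With \<open>c\<close> below the nonzero coordinates of the
  base point \<open>a0\<close>, only the support of \<open>a0\<close> has nonzero weight at \<open>a0\<close>, and the factors \<open>v\<close> make \<open>r\<close> fix \<open>a0\<close>.\<close>

lemma pointed_homotopy_equivalence_nerve_total_snd:
  fixes B :: "'i \<Rightarrow> 'a::real_normed_vector set"
  assumes I: "finite I" and B: "\<And>i. i \<in> I \<Longrightarrow> convex (B i)"
  shows "pointed_homotopy_equivalence (top_of_set (nerve_total I B))
           (top_of_set (realization_points (nerve I B))) snd"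
    (is "pointed_homotopy_equivalence (top_of_set ?Z) (top_of_set ?R) snd")
  unfolding pointed_homotopy_equivalence_def
proof (intro conjI ballI impI)
  have R: "a \<in> ?R \<longleftrightarrow> a \<in> closed_simplex I \<and> (\<exists>y. \<forall>i. a i \<noteq> 0 \<longrightarrow> y \<in> B i)" for a
    by (simp add: realization_points_nerve[OF I])
  have snd_in: "snd z \<in> ?R" if "z \<in> ?Z" for z
    using that unfolding nerve_total_def R by auto blast
  show cont_snd: "continuous_map (top_of_set ?Z) (top_of_set ?R) snd"
    using snd_in by (auto simp: continuous_map_in_subtopology intro!: continuous_on_snd continuous_on_id)
  show "topspace (top_of_set ?R) = {}" if "topspace (top_of_set ?Z) = {}"
    using that by (force simp: nerve_total_def R)
  fix z0 assume "z0 \<in> topspace (top_of_set ?Z)"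
  then have z0_in: "z0 \<in> ?Z" by simp
  then obtain y0 a0 where z0: "z0 = (y0, a0)" "a0 \<in> closed_simplex I" "\<And>i. a0 i \<noteq> 0 \<Longrightarrow> y0 \<in> B i"
    by (auto simp: nerve_total_def)
  have cardI: "0 < card I"
    using I closed_simplex_nonzero[OF z0(2)] by (metis card_gt_0_iff empty_iff)
  \<comment> \<open>The least nonzero coordinate of \<open>a0\<close>, capped at 1 to control
    \<open>c * card I\<close> below.\<close>
  define m where "m = Min (insert 1 (a0 ` {i \<in> I. a0 i \<noteq> 0}))"
  have m: "0 < m" "m \<le> 1" "\<And>i. a0 i \<noteq> 0 \<Longrightarrow> m \<le> a0 i"
  proof -
    have fin: "finite (insert 1 (a0 ` {i \<in> I. a0 i \<noteq> 0}))" using I by simp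
    show "0 < m" unfolding m_def
      by (subst Min_gr_iff[OF fin]) (use closed_simplex_nonneg[OF z0(2)] in \<open>auto simp: less_le\<close>)
    show "m \<le> 1" unfolding m_def using fin by (intro Min_le) auto
    show "m \<le> a0 i" if "a0 i \<noteq> 0" for i
      unfolding m_def using fin that closed_simplex_support[OF z0(2) that] by (auto intro!: Min_le)
  qed
  \<comment> \<open>Small enough for two purposes: \<open>c * card I \<le> 1/2\<close> forces some
    coordinate of every point of the simplex above \<open>c\<close>, so the cut-off vector can be
    normalized; and \<open>c \<le> m/2\<close> leaves the support of \<open>a0\<close>
    intact.\<close>
  define c where "c = m / (2 * card I)"
  have c: "0 < c" "c * card I < 1" "\<And>i. a0 i \<noteq> 0 \<Longrightarrow> c < a0 i"
  proof -
    show "0 < c" "c * card I < 1" using m cardI by (auto simp: c_def)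
    have "c \<le> m / 2" unfolding c_def using m cardI by (intro divide_left_mono) auto
    then show "c < a0 i" if "a0 i \<noteq> 0" for i using m(1) m(3)[OF that] by simp
  qed
  \<comment> \<open>Undoes the cut-off at \<open>a0\<close>: \<open>(a0 i - c) * v i = a0 i\<close>
    on the support.\<close>
  define v where "v i = (if a0 i \<noteq> 0 then a0 i / (a0 i - c) else 1)" for i
  have v: "0 < v i" for i using c(1) c(3)[of i] by (auto simp: v_def)
  define b where "b a i = max 0 (a i - c) * v i" for a i
  have b: "0 \<le> b a i" "b a i \<noteq> 0 \<Longrightarrow> c < a i" "c < a i \<Longrightarrow> b a i > 0" for a i
    using v[of i] by (auto simp: b_def)
  define bs where "bs a = (\<Sum>i\<in>I. b a i)" for a
  have bs: "0 < bs a" if "a \<in> closed_simplex I" for a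
  proof -
    have "\<exists>i\<in>I. c < a i"
    proof (rule ccontr)
      assume "\<not> (\<exists>i\<in>I. c < a i)"
      then have "sum a I \<le> c * card I" using sum_bounded_above[of I a c] by (simp add: not_less mult.commute)
      then show False using c(2) closed_simplex_sum[OF that] by simp
    qed
    then show ?thesis unfolding bs_def using b I by (auto intro!: sum_pos2)
  qed
  define r where "r a i = b a i / bs a" for a i
  have r_simplex: "r a \<in> closed_simplex I" if "a \<in> closed_simplex I" for a
  proof -
    have "sum (r a) I = 1" using bs[OF that] by (simp add: r_def bs_def flip: sum_divide_distrib)
    moreover have "i \<in> I" if "r a i \<noteq> 0" for i
    proof -
      have "c < a i" using that b(2)[of a i] by (auto simp: r_def)
      then show ?thesis using c(1) closed_simplex_support[OF \<open>a \<in> closed_simplex I\<close>] by force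
    qed
    ultimately show ?thesis using b bs[OF that] by (auto simp: closed_simplex_def r_def)
  qed
  have r_supp: "c < a i" "a i \<noteq> 0" if "r a i \<noteq> 0" for a i
    using that b(2)[of a i] c(1) by (auto simp: r_def)
  have r0: "r a0 = a0"
  proof
    fix i
    have "b a0 i = a0 i" for i
      using c(1) c(3)[of i] by (cases "a0 i = 0") (auto simp: b_def v_def)
    then show "r a0 i = a0 i" using closed_simplex_sum[OF z0(2)] by (simp add: r_def bs_def)
  qed
  define N where "N = nerve I B"
  have N: "finite N" unfolding N_def nerve_def by (rule finite_subset[of _ "Pow I"]) (use I in auto)
  \<comment> \<open>The first product vanishes unless \<open>\<sigma>\<close> lies in the support of
    \<open>a\<close>, the second unless \<open>\<sigma>\<close> contains every index with coordinate
    at least \<open>c\<close>.\<close>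
  define W where "W \<sigma> a = (\<Prod>i\<in>\<sigma>. a i) * (\<Prod>j\<in>I - \<sigma>. max 0 (c - a j))" for \<sigma> and a :: "'i \<Rightarrow> real"
  have W: "0 \<le> W \<sigma> a" if "a \<in> closed_simplex I" for \<sigma> a
    unfolding W_def using closed_simplex_nonneg[OF that] by (intro mult_nonneg_nonneg prod_nonneg) auto
  have W_eq_0: "W \<sigma> a = 0" if "i \<in> I" "i \<notin> \<sigma>" "c \<le> a i" for \<sigma> a i
  proof -
    have "(\<Prod>j\<in>I - \<sigma>. max 0 (c - a j)) = 0"
      using I that by (intro prod_zero bexI[of _ i]) auto
    then show ?thesis by (simp add: W_def)
  qed
  define Wt where "Wt a = (\<Sum>\<sigma>\<in>N. W \<sigma> a)" for a
  have Wt: "0 < Wt a" if "a \<in> ?R" for a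
  proof -
    have a: "a \<in> closed_simplex I" using that by (simp add: R)
    \<comment> \<open>The summand of the full support is positive: outside the support each factor
      of the second product equals \<open>c\<close>.\<close>
    have "{i. a i \<noteq> 0} \<in> N" using that by (simp add: N_def realization_points_def)
    moreover have "0 < W {i. a i \<noteq> 0} a"
      unfolding W_def using closed_simplex_nonneg[OF a] closed_simplex_support[OF a] c(1)
      by (intro mult_pos_pos prod_pos) (auto simp: less_le)
    ultimately show ?thesis unfolding Wt_def using W[OF a] N by (intro sum_pos2)
  qed
  define Y where "Y \<sigma> = (if \<sigma> = {i. a0 i \<noteq> 0} then y0 else SOME y. y \<in> (\<Inter>i\<in>\<sigma>. B i))" for \<sigma>
  have Y: "Y \<sigma> \<in> B i" if "\<sigma> \<in> N" "i \<in> \<sigma>" for \<sigma> i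
  proof (cases "\<sigma> = {i. a0 i \<noteq> 0}")
    case True
    then show ?thesis using that z0(3) by (simp add: Y_def)
  next
    case False
    have "\<exists>y. y \<in> (\<Inter>i\<in>\<sigma>. B i)" using that(1) by (auto simp: N_def nerve_def)
    then have "(SOME y. y \<in> (\<Inter>i\<in>\<sigma>. B i)) \<in> (\<Inter>i\<in>\<sigma>. B i)" by (rule someI_ex)
    then show ?thesis using that(2) False by (simp add: Y_def)
  qed
  define y where "y a = (\<Sum>\<sigma>\<in>N. (W \<sigma> a / Wt a) *\<^sub>R Y \<sigma>)" for a
  have y_in: "y a \<in> B i" if a: "a \<in> ?R" and ri: "r a i \<noteq> 0" for a i
  proof -
    have aI: "a \<in> closed_simplex I" using a by (simp add: R)
    have i: "i \<in> I" "c < a i"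
      using closed_simplex_support[OF r_simplex[OF aI] ri] r_supp[OF ri] by auto
    have out: "W \<sigma> a = 0" if "i \<notin> \<sigma>" for \<sigma> using W_eq_0[of i \<sigma> a] i that by simp
    \<comment> \<open>Simplices without \<open>i\<close> have weight 0, so \<open>y a\<close> is a
      convex combination of chosen points that all lie in \<open>B i\<close>.\<close>
    define N' where "N' = {\<sigma> \<in> N. i \<in> \<sigma>}"
    have y': "y a = (\<Sum>\<sigma>\<in>N'. (W \<sigma> a / Wt a) *\<^sub>R Y \<sigma>)"
      unfolding y_def N'_def using N out by (intro sum.mono_neutral_right) auto
    have "Wt a = (\<Sum>\<sigma>\<in>N'. W \<sigma> a)"
      unfolding Wt_def N'_def using N out by (intro sum.mono_neutral_right) auto
    then have "(\<Sum>\<sigma>\<in>N'. W \<sigma> a / Wt a) = 1" using Wt[OF a] by (simp flip: sum_divide_distrib)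
    then show ?thesis
      unfolding y' using N W[OF aI] Wt[OF a] B[OF i(1)] Y
      by (intro convex_sum) (auto simp: N'_def)
  qed
  have a0R: "a0 \<in> ?R" using snd_in[OF z0_in] by (simp add: z0)
  have y0: "y a0 = y0"
  proof -
    have "(W \<sigma> a0 / Wt a0) *\<^sub>R Y \<sigma> = (W \<sigma> a0 / Wt a0) *\<^sub>R y0" if \<sigma>: "\<sigma> \<in> N" for \<sigma>
    proof (cases "W \<sigma> a0 = 0")
      case False
      have "finite \<sigma>" using \<sigma> by (simp add: N_def nerve_def)
      then have "a0 i \<noteq> 0" if "i \<in> \<sigma>" for i using False that by (auto simp: W_def)
      moreover have "i \<in> \<sigma>" if "a0 i \<noteq> 0" for i
        using W_eq_0[of i \<sigma> a0] c(3)[OF that] closed_simplex_support[OF z0(2) that] False by force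
      ultimately have "\<sigma> = {i. a0 i \<noteq> 0}" by blast
      then show ?thesis by (simp add: Y_def)
    qed simp
    then have "y a0 = (\<Sum>\<sigma>\<in>N. (W \<sigma> a0 / Wt a0) *\<^sub>R y0)" unfolding y_def by (intro sum.cong) auto
    also have "\<dots> = (\<Sum>\<sigma>\<in>N. W \<sigma> a0 / Wt a0) *\<^sub>R y0"
      by (rule scaleR_left.sum[symmetric])
    also have "(\<Sum>\<sigma>\<in>N. W \<sigma> a0 / Wt a0) = 1"
      using Wt[OF a0R] by (simp add: Wt_def flip: sum_divide_distrib)
    finally show ?thesis by simp
  qed
  have coord: "continuous_on S (\<lambda>a :: 'i \<Rightarrow> real. a i)" for S i
    by (rule continuous_on_product_then_coordinatewise) (rule continuous_on_id)
  have r_cont: "continuous_on ?R (\<lambda>a. r a i)" for i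
    unfolding r_def bs_def b_def
    by (intro continuous_intros coord) (use bs in \<open>force simp: R bs_def b_def\<close>)
  have y_cont: "continuous_on ?R y"
    unfolding y_def Wt_def W_def
    by (intro continuous_intros coord) (use Wt in \<open>force simp: Wt_def W_def\<close>)
  have r_in: "r a \<in> ?R" "(y a, r a) \<in> ?Z" if "a \<in> ?R" for a
    using that r_simplex[of a] y_in[OF that] by (auto simp: R nerve_total_def)
  define g where "g a = (y a, r a)" for a
  have contg: "continuous_map (top_of_set ?R) (top_of_set ?Z) g"
    using r_in(2) unfolding g_def
    by (auto simp: continuous_map_in_subtopology
        intro!: continuous_intros continuous_on_coordinatewise_then_product r_cont y_cont)
  have [continuous_intros]: "continuous_on ({0..1::real} \<times> ?Z) (\<lambda>x. r (snd (snd x)) i)" for i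
    by (rule continuous_on_compose2[OF r_cont]) (use snd_in in \<open>auto intro!: continuous_on_snd continuous_on_id\<close>)
  have [continuous_intros]: "continuous_on ({0..1::real} \<times> ?Z) (\<lambda>x. y (snd (snd x)))"
    by (rule continuous_on_compose2[OF y_cont]) (use snd_in in \<open>auto intro!: continuous_on_snd continuous_on_id\<close>)
  have [continuous_intros]: "continuous_on ({0..1::real} \<times> ?Z) (\<lambda>x. snd (snd x) i)" for i
    by (rule continuous_on_product_then_coordinatewise) (intro continuous_on_snd continuous_on_id)
  \<comment> \<open>Two stages. While the point moves from \<open>y a\<close> to \<open>x\<close>,
    the coordinates stay at \<open>r a\<close>, since \<open>y a\<close> is known to lie only in the
    sets of that smaller support. Once the point is \<open>x\<close>, the coordinates may move from
    \<open>r a\<close> to \<open>a\<close>.\<close>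
  have "homotopic_with (\<lambda>q. q z0 = z0) (top_of_set ?Z) (top_of_set ?Z) (g \<circ> snd) (\<lambda>z. (fst z, r (snd z)))"
  proof (rule homotopic_with_pointed_on[where h = "\<lambda>(t, (x, a)). ((1 - t) *\<^sub>R y a + t *\<^sub>R x, r a)"])
    show "continuous_on ({0..1} \<times> ?Z) (\<lambda>(t, (x, a)). ((1 - t) *\<^sub>R y a + t *\<^sub>R x, r a))"
      unfolding split_beta
      by (intro continuous_intros continuous_on_coordinatewise_then_product)
    fix t :: real and z assume t: "t \<in> {0..1}" and z: "z \<in> ?Z"
    obtain x a where xa: "z = (x, a)" "a \<in> closed_simplex I" "\<And>i. a i \<noteq> 0 \<Longrightarrow> x \<in> B i"
      using z by (auto simp: nerve_total_def)
    have "(1 - t) *\<^sub>R y a + t *\<^sub>R x \<in> B i" if "r a i \<noteq> 0" for i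
      using y_in[of a i] snd_in[OF z] that xa(1) xa(3)[OF r_supp(2)[OF that]] t
        B[OF closed_simplex_support[OF r_simplex[OF xa(2)] that]]
      by (intro convexD) auto
    then show "(case (t, z) of (t, x, a) \<Rightarrow> ((1 - t) *\<^sub>R y a + t *\<^sub>R x, r a)) \<in> ?Z"
      using xa r_simplex[OF xa(2)] by (auto simp: nerve_total_def)
  qed (auto simp: z0 r0 y0 g_def z0_in[unfolded z0] algebra_simps)
  moreover have "homotopic_with (\<lambda>q. q z0 = z0) (top_of_set ?Z) (top_of_set ?Z) (\<lambda>z. (fst z, r (snd z))) id"
  proof (rule homotopic_with_pointed_on[where h = "\<lambda>(t, (x, a)). (x, \<lambda>i. (1 - t) * r a i + t * a i)"])
    show "continuous_on ({0..1} \<times> ?Z) (\<lambda>(t, (x, a)). (x, \<lambda>i. (1 - t) * r a i + t * a i))"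
      unfolding split_beta
      by (intro continuous_intros continuous_on_coordinatewise_then_product)
    fix t :: real and z assume t: "t \<in> {0..1}" and z: "z \<in> ?Z"
    obtain x a where xa: "z = (x, a)" "a \<in> closed_simplex I" "\<And>i. a i \<noteq> 0 \<Longrightarrow> x \<in> B i"
      using z by (auto simp: nerve_total_def)
    have "x \<in> B i" if "(1 - t) * r a i + t * a i \<noteq> 0" for i
      using that xa(3)[of i] r_supp(2)[of a i] by fastforce
    then show "(case (t, z) of (t, x, a) \<Rightarrow> (x, \<lambda>i. (1 - t) * r a i + t * a i)) \<in> ?Z"
      using xa(1) closed_simplex_interpolation[OF r_simplex[OF xa(2)] xa(2) t] by (auto simp: nerve_total_def)
  qed (auto simp: z0 r0 z0_in[unfolded z0] algebra_simps)
  ultimately have "homotopic_with (\<lambda>q. q z0 = z0) (top_of_set ?Z) (top_of_set ?Z) (g \<circ> snd) id"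
    by (rule homotopic_with_trans)
  \<comment> \<open>Here the composite is \<open>r\<close>. The supports along the segment from
    \<open>r a\<close> to \<open>a\<close> lie in that of \<open>a\<close>, so one common point for
    \<open>a\<close> serves throughout.\<close>
  moreover have "homotopic_with (\<lambda>q. q (snd z0) = snd z0) (top_of_set ?R) (top_of_set ?R) (snd \<circ> g) id"
  proof (rule homotopic_with_pointed_on[where h = "\<lambda>(t, a). (\<lambda>i. (1 - t) * r a i + t * a i)"])
    have [continuous_intros]: "continuous_on ({0..1::real} \<times> ?R) (\<lambda>x. r (snd x) i)" for i
      by (rule continuous_on_compose2[OF r_cont]) (auto intro!: continuous_on_snd continuous_on_id)
    have [continuous_intros]: "continuous_on ({0..1::real} \<times> ?R) (\<lambda>x. snd x i)" for i
      by (rule continuous_on_product_then_coordinatewise) (intro continuous_on_snd continuous_on_id)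
    show "continuous_on ({0..1} \<times> ?R) (\<lambda>(t, a). (\<lambda>i. (1 - t) * r a i + t * a i))"
      unfolding split_beta
      by (intro continuous_intros continuous_on_coordinatewise_then_product)
    fix t :: real and a assume t: "t \<in> {0..1}" and a: "a \<in> ?R"
    obtain x where xa: "a \<in> closed_simplex I" "\<And>i. a i \<noteq> 0 \<Longrightarrow> x \<in> B i"
      using a by (auto simp: R)
    have "x \<in> B i" if "(1 - t) * r a i + t * a i \<noteq> 0" for i
      using that xa(2)[of i] r_supp(2)[of a i] by fastforce
    then show "(case (t, a) of (t, a) \<Rightarrow> (\<lambda>i. (1 - t) * r a i + t * a i)) \<in> ?R"
      using closed_simplex_interpolation[OF r_simplex[OF xa(1)] xa(1) t] by (auto simp: R)
  qed (use a0R in \<open>auto simp: z0 r0 g_def algebra_simps\<close>)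
  ultimately show "\<exists>g. continuous_map (top_of_set ?R) (top_of_set ?Z) g \<and> g (snd z0) = z0 \<and>
      homotopic_with (\<lambda>q. q z0 = z0) (top_of_set ?Z) (top_of_set ?Z) (g \<circ> snd) id \<and>
      homotopic_with (\<lambda>q. q (snd z0) = snd z0) (top_of_set ?R) (top_of_set ?R) (snd \<circ> g) id"
    using contg by (intro exI[of _ g]) (auto simp: g_def z0 r0 y0)
qed

section \<open>The \<open>p\<close>-norm\<close>

lemma powr_convex_combination:
  fixes u v s t q :: real
  assumes "1 \<le> q" "0 \<le> u" "0 \<le> v" "0 \<le> s" "0 \<le> t" "s + t = 1"
  shows "(s * u + t * v) powr q \<le> s * u powr q + t * v powr q"
proof -
  \<comment> \<open>Covers the cases where \<open>u\<close> or \<open>v\<close> is 0, in which the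
    claim reduces to \<open>r powr q \<le> r\<close> on the unit interval.\<close>
  have scale: "(r * w) powr q \<le> r * w powr q" if "0 \<le> r" "r \<le> 1" "0 \<le> w" for r w :: real
  proof -
    have "r powr q \<le> r powr 1" if "0 < r"
      using powr_mono'[of 1 q r] assms(1) \<open>r \<le> 1\<close> that by simp
    then have "r powr q \<le> r" using \<open>0 \<le> r\<close> by (cases "r = 0") auto
    then show ?thesis using that by (simp add: powr_mult mult_right_mono)
  qed
  consider "u = 0" | "v = 0" | "0 < u" "0 < v" using assms by fastforce
  then show ?thesis
  proof cases
    case 3
    have "t \<le> 1" and s: "s = 1 - t" using assms by auto
    then show ?thesis
      using convex_onD[OF powr_convex[OF assms(1)], of t u v] assms 3 unfolding s by simp
  qed (use assms scale[of s u] scale[of t v] in auto)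
qed

lemma powr_le_powr_iff:
  fixes x y q :: real
  assumes "0 < q" "0 \<le> x" "0 \<le> y"
  shows "x powr q \<le> y powr q \<longleftrightarrow> x \<le> y"
  using assms powr_mono2[of q x y] powr_less_mono2[of q y x] by (auto simp: not_le[symmetric])

lemma pnorm_cases:
  assumes "1 \<le> p"
  obtains "p = \<infinity>" | q where "p = ereal q" "1 \<le> q"
  using assms by (cases p) auto

lemma pnorm_finite: "pnorm (ereal q) x = (\<Sum>i\<in>UNIV. \<bar>x $ i\<bar> powr q) powr (1 / q)"
  by (simp add: pnorm_def)

lemma pnorm_infinity: "pnorm \<infinity> x = Max (range (\<lambda>i. \<bar>x $ i\<bar>))"
  by (simp add: pnorm_def)

lemma pnorm_powr: "1 \<le> q \<Longrightarrow> pnorm (ereal q) x powr q = (\<Sum>i\<in>UNIV. \<bar>x $ i\<bar> powr q)"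
  by (simp add: pnorm_finite powr_powr sum_nonneg)

lemma pnorm_le_iff:
  assumes "1 \<le> q" "0 \<le> c"
  shows "pnorm (ereal q) x \<le> c \<longleftrightarrow> (\<Sum>i\<in>UNIV. \<bar>x $ i\<bar> powr q) \<le> c powr q"
proof -
  have "pnorm (ereal q) x \<le> c \<longleftrightarrow> pnorm (ereal q) x powr q \<le> c powr q"
    using assms powr_le_powr_iff[of q "pnorm (ereal q) x" c] by (simp add: pnorm_finite)
  then show ?thesis using assms by (simp add: pnorm_powr)
qed

lemma component_le_pnorm:
  assumes "1 \<le> p"
  shows "\<bar>x $ i\<bar> \<le> pnorm p x"
  using assms
proof (cases rule: pnorm_cases)
  case 1
  then show ?thesis by (simp add: pnorm_infinity)
next
  case (2 q)
  have "\<bar>x $ i\<bar> powr q \<le> pnorm p x powr q"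
    using 2 by (auto simp: pnorm_powr intro: member_le_sum)
  then show ?thesis
    using 2 powr_le_powr_iff[of q "\<bar>x $ i\<bar>" "pnorm p x"] by (simp add: pnorm_finite)
qed

lemma pnorm_nonneg: "1 \<le> p \<Longrightarrow> 0 \<le> pnorm p x"
  using component_le_pnorm[of p x undefined] abs_ge_zero order_trans by blast

lemma pnorm_scale:
  assumes "1 \<le> p"
  shows "pnorm p (c *\<^sub>R x) = \<bar>c\<bar> * pnorm p x"
  using assms
proof (cases rule: pnorm_cases)
  case 1
  have "pnorm \<infinity> (c *\<^sub>R x) = Max ((\<lambda>t. \<bar>c\<bar> * t) ` range (\<lambda>i. \<bar>x $ i\<bar>))"
    by (simp add: pnorm_infinity abs_mult image_image)
  also have "\<dots> = \<bar>c\<bar> * Max (range (\<lambda>i. \<bar>x $ i\<bar>))"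
    by (rule mono_Max_commute[symmetric]) (auto intro!: monoI mult_left_mono)
  finally show ?thesis using 1 by (simp add: pnorm_infinity)
next
  case (2 q)
  then show ?thesis
    by (simp add: pnorm_finite abs_mult powr_mult sum_nonneg powr_powr flip: sum_distrib_left)
qed

lemma pnorm_zero: "1 \<le> p \<Longrightarrow> pnorm p 0 = 0"
  using pnorm_scale[of p 0 0] by simp

lemma pnorm_minus_commute: "1 \<le> p \<Longrightarrow> pnorm p (x - y) = pnorm p (y - x)"
  using pnorm_scale[of p "-1" "x - y"] by simp

lemma pnorm_eq_0_iff:
  assumes "1 \<le> p"
  shows "pnorm p x = 0 \<longleftrightarrow> x = 0"
proof
  assume "pnorm p x = 0"
  then have "\<bar>x $ i\<bar> \<le> 0" for i using component_le_pnorm[OF assms, of x i] by simp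
  then show "x = 0" by (simp add: vec_eq_iff)
qed (use assms pnorm_zero in simp)

text \<open>For finite exponent this is Minkowski's inequality: apply convexity of the power
  function to the coordinates of \<open>x\<close> and \<open>y\<close> divided by their norms, then
  sum; both normalized sums are 1.\<close>

lemma pnorm_triangle:
  assumes p: "1 \<le> p"
  shows "pnorm p (x + y) \<le> pnorm p x + pnorm p y"
  using assms
proof (cases rule: pnorm_cases)
  case 1
  have "\<bar>(x + y) $ i\<bar> \<le> pnorm p x + pnorm p y" for i
    using component_le_pnorm[OF p, of x i] component_le_pnorm[OF p, of y i] by simp
  then show ?thesis using 1 by (auto simp: pnorm_infinity)
next
  case (2 q)
  define A B where "A = pnorm p x" and "B = pnorm p y"
  show ?thesis
  proof (cases "x = 0 \<or> y = 0")
    case True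
    then show ?thesis using p by (auto simp: pnorm_zero)
  next
    case False
    then have AB: "0 < A" "0 < B"
      using p pnorm_eq_0_iff pnorm_nonneg by (auto simp: A_def B_def less_le)
    \<comment> \<open>The weights for which the normalized vectors \<open>x / A\<close> and
      \<open>y / B\<close> average to \<open>(x + y) / (A + B)\<close>.\<close>
    define s t where "s = A / (A + B)" and "t = B / (A + B)"
    have st: "0 \<le> s" "0 \<le> t" "s + t = 1" using AB by (auto simp: s_def t_def simp flip: add_divide_distrib)
    have "\<bar>(x + y) $ i\<bar> powr q \<le> (A + B) powr q * (s * (\<bar>x $ i\<bar> powr q / A powr q) + t * (\<bar>y $ i\<bar> powr q / B powr q))" for i
    proof -
      have "(A + B) * (s * (\<bar>x $ i\<bar> / A) + t * (\<bar>y $ i\<bar> / B)) = (A + B) * ((\<bar>x $ i\<bar> + \<bar>y $ i\<bar>) / (A + B))"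
        using AB by (simp add: s_def t_def add_divide_distrib)
      then have "\<bar>(x + y) $ i\<bar> \<le> (A + B) * (s * (\<bar>x $ i\<bar> / A) + t * (\<bar>y $ i\<bar> / B))"
        using AB by simp
      then have "\<bar>(x + y) $ i\<bar> powr q \<le> ((A + B) * (s * (\<bar>x $ i\<bar> / A) + t * (\<bar>y $ i\<bar> / B))) powr q"
        using 2 by (intro powr_mono2) auto
      also have "\<dots> = (A + B) powr q * (s * (\<bar>x $ i\<bar> / A) + t * (\<bar>y $ i\<bar> / B)) powr q"
        using AB st by (intro powr_mult)
      also have "\<dots> \<le> (A + B) powr q * (s * (\<bar>x $ i\<bar> / A) powr q + t * (\<bar>y $ i\<bar> / B) powr q)"
        using AB st 2 by (intro mult_left_mono powr_convex_combination) auto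
      finally show ?thesis using AB by (simp add: powr_divide)
    qed
    then have "(\<Sum>i\<in>UNIV. \<bar>(x + y) $ i\<bar> powr q)
        \<le> (\<Sum>i\<in>UNIV. (A + B) powr q * (s * (\<bar>x $ i\<bar> powr q / A powr q) + t * (\<bar>y $ i\<bar> powr q / B powr q)))"
      by (intro sum_mono)
    also have "\<dots> = (A + B) powr q * (s * ((\<Sum>i\<in>UNIV. \<bar>x $ i\<bar> powr q) / A powr q) + t * ((\<Sum>i\<in>UNIV. \<bar>y $ i\<bar> powr q) / B powr q))"
      by (simp only: sum_divide_distrib sum_distrib_left sum.distrib[symmetric])
    also have "\<dots> = (A + B) powr q"
    proof -
      have "(\<Sum>i\<in>UNIV. \<bar>x $ i\<bar> powr q) = A powr q" "(\<Sum>i\<in>UNIV. \<bar>y $ i\<bar> powr q) = B powr q"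
        using 2 pnorm_powr[of q x] pnorm_powr[of q y] by (simp_all add: A_def B_def)
      then show ?thesis using AB st by simp
    qed
    finally show ?thesis
      using 2 AB pnorm_le_iff[of q "A + B" "x + y"] by (simp add: A_def B_def)
  qed
qed

lemma pnorm_triangle_diff:
  assumes "1 \<le> p"
  shows "pnorm p (x - z) \<le> pnorm p (x - y) + pnorm p (y - z)"
  using pnorm_triangle[OF assms, of "x - y" "y - z"] by simp

lemma convex_on_pnorm:
  assumes "1 \<le> p"
  shows "convex_on UNIV (pnorm p)"
proof (rule convex_onI)
  fix t :: real and x y :: "real ^ 'n" assume "0 < t" "t < 1"
  then show "pnorm p ((1 - t) *\<^sub>R x + t *\<^sub>R y) \<le> (1 - t) * pnorm p x + t * pnorm p y"
    using pnorm_triangle[OF assms, of "(1 - t) *\<^sub>R x" "t *\<^sub>R y"] by (simp add: pnorm_scale[OF assms])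
qed simp

text \<open>A convex function on an open subset of a Euclidean space is continuous.\<close>

lemma continuous_on_pnorm:
  fixes f :: "'a::topological_space \<Rightarrow> real ^ 'n"
  assumes "1 \<le> p" "continuous_on S f"
  shows "continuous_on S (\<lambda>x. pnorm p (f x))"
  using convex_on_continuous[OF open_UNIV convex_on_pnorm[OF assms(1)]] assms(2)
  by (rule continuous_on_compose2) auto

lemma convex_pnorm_ball:
  assumes "1 \<le> p"
  shows "convex {y. pnorm p (x - y) < r}"
proof (rule convexI)
  fix y z and s t :: real
  assume yz: "y \<in> {y. pnorm p (x - y) < r}" "z \<in> {y. pnorm p (x - y) < r}" and st: "0 \<le> s" "0 \<le> t" "s + t = 1"
  have "x - (s *\<^sub>R y + t *\<^sub>R z) = s *\<^sub>R (x - y) + t *\<^sub>R (x - z)"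
    using st by (simp add: algebra_simps flip: scaleR_add_left)
  then have "pnorm p (x - (s *\<^sub>R y + t *\<^sub>R z)) \<le> s * pnorm p (x - y) + t * pnorm p (x - z)"
    using pnorm_triangle[OF assms, of "s *\<^sub>R (x - y)" "t *\<^sub>R (x - z)"] st by (simp add: pnorm_scale[OF assms])
  also have "\<dots> < r"
    using yz st by (intro convex_bound_lt) auto
  finally show "s *\<^sub>R y + t *\<^sub>R z \<in> {y. pnorm p (x - y) < r}" by simp
qed

lemma open_pnorm_ball:
  assumes "1 \<le> p"
  shows "open {y. pnorm p (x - y) < r}"
  by (intro open_Collect_less continuous_on_pnorm[OF assms] continuous_intros)

lemma compact_pnorm_ball:
  fixes x :: "real ^ 'n"
  assumes p: "1 \<le> p"
  shows "compact {y. pnorm p (x - y) \<le> r}"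
  unfolding compact_eq_bounded_closed
proof
  have "norm (x - y) \<le> CARD('n) * pnorm p (x - y)" for y
  proof -
    have "norm (x - y) \<le> (\<Sum>i\<in>UNIV. \<bar>(x - y) $ i\<bar>)" by (rule norm_le_l1_cart)
    also have "\<dots> \<le> CARD('n) * pnorm p (x - y)"
      using sum_bounded_above[of UNIV "\<lambda>i. \<bar>(x - y) $ i\<bar>" "pnorm p (x - y)"] component_le_pnorm[OF p, of "x - y"] by simp
    finally show ?thesis .
  qed
  then have "dist x y \<le> CARD('n) * r" if "pnorm p (x - y) \<le> r" for y
    using that mult_left_mono[OF that, of "real CARD('n)"] by (force simp: dist_norm intro: order_trans)
  then show "bounded {y. pnorm p (x - y) \<le> r}"
    unfolding bounded_def by auto
  show "closed {y. pnorm p (x - y) \<le> r}"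
    by (intro closed_Collect_le continuous_on_pnorm[OF p] continuous_intros)
qed

text \<open>Hausdorff measure and the density of samples refer to the Euclidean distance, the
  filtrations to the \<open>p\<close>-norm; this translates between them.\<close>

lemma pnorm_less_near:
  fixes p :: ereal and \<delta> :: real
  assumes p: "1 \<le> p" and \<delta>: "0 < \<delta>"
  obtains \<eta> :: real where "0 < \<eta>" "\<And>x y :: real ^ 'n. dist x y < \<eta> \<Longrightarrow> pnorm p (x - y) < \<delta>"
proof -
  have "open {y. pnorm p (0 - y :: real ^ 'n) < \<delta>}" "0 \<in> {y. pnorm p (0 - y :: real ^ 'n) < \<delta>}"
    using open_pnorm_ball[OF p, of 0] \<delta> by (auto simp: pnorm_zero[OF p])
  then obtain \<eta> where \<eta>: "0 < \<eta>" "ball 0 \<eta> \<subseteq> {y. pnorm p (0 - y :: real ^ 'n) < \<delta>}"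
    by (meson openE)
  show ?thesis
  proof (rule that[OF \<eta>(1)])
    fix x y :: "real ^ 'n" assume "dist x y < \<eta>"
    then have "y - x \<in> ball 0 \<eta>" by (simp add: dist_norm norm_minus_commute)
    then show "pnorm p (x - y) < \<delta>" using \<eta>(2) by auto
  qed
qed

section \<open>Sublevel filtrations\<close>

lemma sublevel_rspace_metrizable:
  assumes "metrizable_space T"
  shows "obj (sublevel_rspace T \<gamma>) r = subtopology T {x. \<gamma> x \<le> r}"
proof -
  have "subtopology T {x \<in> topspace T. \<gamma> x \<le> r} = subtopology T {x. \<gamma> x \<le> r}"
    using subtopology_restrict[of T "{x. \<gamma> x \<le> r}"] by (simp add: Collect_conj_eq)
  then show ?thesis
    by (simp add: sublevel_rspace_def cg_ification_metrizable metrizable_space_subtopology[OF assms])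
qed

lemma is_rspace_sublevel:
  assumes "metrizable_space T"
  shows "is_rspace (sublevel_rspace T \<gamma>)"
proof -
  have "continuous_map (subtopology T {x. \<gamma> x \<le> r}) (subtopology T {x. \<gamma> x \<le> s}) (\<lambda>x. x)" if "r \<le> s" for r s
    using that continuous_map_id_subt[of T "{x. \<gamma> x \<le> r}"]
    by (auto simp: continuous_map_in_subtopology id_def)
  then show ?thesis
    unfolding is_rspace_def sublevel_rspace_metrizable[OF assms]
    using CGWH_metrizable[OF metrizable_space_subtopology[OF assms]]
    by (auto simp: sublevel_rspace_def)
qed

lemma obj_sublevel_transport:
  assumes "inj e" "metrizable_space X"
  shows "obj (sublevel_rspace (transport_topology e X) (\<gamma> \<circ> inv e)) r
    = transport_topology e (subtopology X {x. \<gamma> x \<le> r})"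
  using subtopology_transport_topology[OF assms(1), of X "\<lambda>x. \<gamma> x \<le> r"]
  by (simp add: sublevel_rspace_metrizable[OF metrizable_transport_topology[OF assms]])

text \<open>Internal maps that agree only for \<open>r \<le> s\<close> and only on the points of the
  spaces need not be equal as functions, so the \<open>\<real>\<close>-spaces are linked by identity
  maps rather than by equality.\<close>

lemma rspace_cong:
  assumes S: "is_rspace S" and obj: "\<And>r. obj X r = obj S r"
    and arr: "\<And>r s x. r \<le> s \<Longrightarrow> x \<in> topspace (obj S r) \<Longrightarrow> arr X r s x = arr S r s x"
  shows "is_rspace X" "weakly_equivalent X S"
proof -
  have cont: "continuous_map (obj S r) (obj S s) (arr S r s)" if "r \<le> s" for r s
    using S that by (simp add: is_rspace_def)
  have arr_in: "arr S r s x \<in> topspace (obj S s)" if "r \<le> s" "x \<in> topspace (obj S r)" for r s x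
    using cont[OF that(1)] that(2) by (auto simp: continuous_map_def)
  show X: "is_rspace X"
    unfolding is_rspace_def obj
  proof (intro conjI allI impI ballI)
    show "continuous_map (obj S r) (obj S s) (arr X r s)" if "r \<le> s" for r s
      by (rule continuous_map_eq[OF cont[OF that]]) (simp add: arr that)
  qed (use S arr arr_in in \<open>auto simp: is_rspace_def\<close>)
  have "weak_homotopy_equivalence T T (\<lambda>x. x)" for T :: "'a topology"
    by (rule weak_homotopy_equivalence_pointed, rule pointed_homotopy_equivalence_homeomorphic[of _ _ _ "\<lambda>x. x"])
      (simp add: homeomorphic_maps_def)
  then have "objectwise_weak_equivalence X S (\<lambda>r x. x)"
    unfolding objectwise_weak_equivalence_def natural_transformation_def by (simp add: obj arr)
  then show "weakly_equivalent X S"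
    unfolding weakly_equivalent_def using S X by (intro r_into_equivclp) auto
qed

text \<open>The same \<open>f\<close> serves at every index and internal maps are inclusions, so
  naturality is immediate.\<close>

lemma weakly_equivalent_sublevel:
  assumes e: "inj e" "inj e'" and X: "metrizable_space X" "metrizable_space X'"
    and f: "\<And>r. pointed_homotopy_equivalence (subtopology X {x. \<gamma> x \<le> r}) (subtopology X' {x. \<gamma>' x \<le> r}) f"
  shows "weakly_equivalent (sublevel_rspace (transport_topology e X) (\<gamma> \<circ> inv e))
                           (sublevel_rspace (transport_topology e' X') (\<gamma>' \<circ> inv e'))"
    (is "weakly_equivalent ?S ?S'")
proof -
  have "pointed_homotopy_equivalence (obj ?S r) (obj ?S' r) (e' \<circ> (f \<circ> inv e))" for r
    unfolding obj_sublevel_transport[OF e(1) X(1)] obj_sublevel_transport[OF e(2) X(2)]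
  proof (intro pointed_homotopy_equivalence_compose)
    show "pointed_homotopy_equivalence (transport_topology e (subtopology X {x. \<gamma> x \<le> r}))
        (subtopology X {x. \<gamma> x \<le> r}) (inv e)"
      using homeomorphic_maps_transport_topology[OF e(1)] homeomorphic_maps_sym
      by (intro pointed_homotopy_equivalence_homeomorphic) blast
    show "pointed_homotopy_equivalence (subtopology X' {x. \<gamma>' x \<le> r})
        (transport_topology e' (subtopology X' {x. \<gamma>' x \<le> r})) e'"
      by (rule pointed_homotopy_equivalence_homeomorphic[OF homeomorphic_maps_transport_topology[OF e(2)]])
  qed (rule f)
  then have "weak_homotopy_equivalence (obj ?S r) (obj ?S' r) (e' \<circ> (f \<circ> inv e))" for r
    by (rule weak_homotopy_equivalence_pointed)
  then have "objectwise_weak_equivalence ?S ?S' (\<lambda>r. e' \<circ> (f \<circ> inv e))"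
    unfolding objectwise_weak_equivalence_def natural_transformation_def
    by (simp add: weak_homotopy_equivalence_def) (simp add: sublevel_rspace_def)
  then show ?thesis
    unfolding weakly_equivalent_def
    using is_rspace_sublevel[OF metrizable_transport_topology[OF e(1) X(1)]]
      is_rspace_sublevel[OF metrizable_transport_topology[OF e(2) X(2)]]
    by (intro r_into_equivclp) auto
qed

text \<open>There are finitely many closed simplices, each closed in the product topology. A set
  whose trace on each of them is closed is therefore a finite union of closed sets, and the weak
  topology is the subspace topology.\<close>

lemma geometric_realization_nerve:
  assumes I: "finite I"
  shows "geometric_realization (nerve I B) = top_of_set (realization_points (nerve I B))"
proof -
  let ?S = "nerve I B"
  have S: "finite ?S" "\<And>\<sigma>. \<sigma> \<in> ?S \<Longrightarrow> finite \<sigma> \<and> \<sigma> \<subseteq> I"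
    unfolding nerve_def using finite_subset[OF _ I] by (auto intro: finite_subset[of _ "Pow I"] simp: I)
  have coord: "continuous_on UNIV (\<lambda>a :: 'a \<Rightarrow> real. a i)" for i
    by (rule continuous_on_product_then_coordinatewise) (rule continuous_on_id)
  have closed: "closed (closed_simplex \<sigma>)" for \<sigma> :: "'a set"
  proof -
    have "closed_simplex \<sigma> = (\<Inter>i. {a. 0 \<le> a i}) \<inter> (\<Inter>i\<in>-\<sigma>. {a. a i = 0}) \<inter> {a :: 'a \<Rightarrow> real. sum a \<sigma> = 1}"
      by (auto simp: closed_simplex_def)
    moreover have "closed {a :: 'a \<Rightarrow> real. 0 \<le> a i}" "closed {a :: 'a \<Rightarrow> real. a i = 0}" for i
      by (intro closed_Collect_le coord continuous_on_const closed_Collect_eq)+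
    moreover have "closed {a :: 'a \<Rightarrow> real. sum a \<sigma> = 1}"
      by (intro closed_Collect_eq continuous_on_const continuous_on_sum coord)
    ultimately show ?thesis by (auto intro!: closed_Int closed_INT)
  qed
  have points: "realization_points ?S = (\<Union>\<sigma>\<in>?S. closed_simplex \<sigma>)"
  proof (intro equalityI subsetI)
    fix a assume "a \<in> realization_points ?S"
    then show "a \<in> (\<Union>\<sigma>\<in>?S. closed_simplex \<sigma>)"
      by (intro UN_I[of "{i. a i \<noteq> 0}"]) (auto simp: realization_points_def closed_simplex_def)
  next
    fix a assume "a \<in> (\<Union>\<sigma>\<in>?S. closed_simplex \<sigma>)"
    then obtain \<sigma> where \<sigma>: "\<sigma> \<in> ?S" "a \<in> closed_simplex \<sigma>" by blast
    obtain y where "\<And>i. i \<in> \<sigma> \<Longrightarrow> y \<in> B i" using \<sigma>(1) by (auto simp: nerve_def)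
    moreover have "sum a \<sigma> = sum a I"
      using \<sigma> S(2)[OF \<sigma>(1)] I by (intro sum.mono_neutral_left) (auto simp: closed_simplex_def)
    then have "a \<in> closed_simplex I" using \<sigma> S(2)[OF \<sigma>(1)] by (auto simp: closed_simplex_def)
    ultimately show "a \<in> realization_points ?S"
      using closed_simplex_support[OF \<sigma>(2)] unfolding realization_points_nerve[OF I] by blast
  qed
  have "realization_open ?S U \<longleftrightarrow> openin (top_of_set (realization_points ?S)) U" for U
  proof
    assume U: "realization_open ?S U"
    have sub: "U \<subseteq> realization_points ?S" using U by (simp add: realization_open_def)
    have "closed (closed_simplex \<sigma> - U)" if \<sigma>: "\<sigma> \<in> ?S" for \<sigma>
    proof -
      have "openin (top_of_set (closed_simplex \<sigma>)) (U \<inter> closed_simplex \<sigma>)"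
        using U \<sigma> by (simp add: realization_open_def)
      then have "closedin (top_of_set (closed_simplex \<sigma>)) (closed_simplex \<sigma> - U \<inter> closed_simplex \<sigma>)"
        by (metis closedin_def closedin_topspace openin_closedin_eq topspace_euclidean_subtopology)
      then show ?thesis using closedin_closed_trans[OF _ closed] by (simp add: Diff_Int)
    qed
    then have "closed (\<Union>\<sigma>\<in>?S. closed_simplex \<sigma> - U)" using S(1) by (intro closed_UN) auto
    moreover have "(\<Union>\<sigma>\<in>?S. closed_simplex \<sigma> - U) = realization_points ?S - U"
      unfolding points by blast
    ultimately have "closedin (top_of_set (realization_points ?S)) (realization_points ?S - U)"
      by (metis Diff_subset closed_subset)
    then show "openin (top_of_set (realization_points ?S)) U"
      using sub by (simp add: openin_closedin_eq)
  next
    assume "openin (top_of_set (realization_points ?S)) U"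
    then obtain V where V: "open V" "U = realization_points ?S \<inter> V" by (auto simp: openin_open)
    have "U \<inter> closed_simplex \<sigma> = closed_simplex \<sigma> \<inter> V" if "\<sigma> \<in> ?S" for \<sigma>
      using that unfolding V(2) points by blast
    then show "realization_open ?S U"
      unfolding realization_open_def using V by (auto simp: openin_open)
  qed
  then show ?thesis by (simp add: topology_eq openin_geometric_realization)
qed

text \<open>The index type may be uncountable, so the ambient function space need not be metrizable.
  Coordinates outside \<open>I\<close> vanish, which places the simplex in a product with only
  finitely many nontrivial factors.\<close>

lemma metrizable_space_closed_simplex:
  assumes I: "finite I"
  shows "metrizable_space (top_of_set (closed_simplex I))"
proof -
  define Y :: "'a \<Rightarrow> real set" where "Y i = (if i \<in> I then UNIV else {0})" for i
  have "{i. \<not> (\<exists>a. topspace (top_of_set (Y i)) \<subseteq> {a})} \<subseteq> I" by (auto simp: Y_def)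
  then have "countable {i \<in> UNIV. \<not> (\<exists>a. topspace (top_of_set (Y i)) \<subseteq> {a})}"
    using I by (auto intro: countable_finite finite_subset)
  then have "metrizable_space (product_topology (\<lambda>i. top_of_set (Y i)) UNIV)"
    unfolding metrizable_space_product_topology
    by (simp add: metrizable_space_subtopology metrizable_space_euclidean)
  then have "metrizable_space (top_of_set (Pi\<^sub>E UNIV Y))"
    unfolding subtopology_product_topology[symmetric] euclidean_product_topology .
  moreover have "closed_simplex I \<subseteq> Pi\<^sub>E UNIV Y" by (auto simp: closed_simplex_def Y_def)
  ultimately show ?thesis
    by (metis inf.absorb2 metrizable_space_subtopology subtopology_subtopology)
qed

section \<open>Distance functions, enclosing radii and rounding\<close>

lemma attains_Inf:
  fixes f :: "'a::topological_space \<Rightarrow> real"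
  assumes "compact K" "K \<noteq> {}" "continuous_on K f"
  shows "\<exists>x\<in>K. f x = Inf (f ` K) \<and> (\<forall>y\<in>K. f x \<le> f y)"
proof -
  obtain x where x: "x \<in> K" "\<And>y. y \<in> K \<Longrightarrow> f x \<le> f y"
    using continuous_attains_inf[OF assms] by blast
  then have "Inf (f ` K) = f x" by (intro cInf_eq_minimum) auto
  then show ?thesis using x by auto
qed

definition set_pdist :: "ereal \<Rightarrow> (real ^ 'n) set \<Rightarrow> real ^ 'n \<Rightarrow> real" where
  "set_pdist p K y = Inf ((\<lambda>x. pnorm p (x - y)) ` K)"

lemma set_pdist_attained:
  assumes "1 \<le> p" "compact K" "K \<noteq> {}"
  obtains x where "x \<in> K" "set_pdist p K y = pnorm p (x - y)"
    "\<And>z. z \<in> K \<Longrightarrow> pnorm p (x - y) \<le> pnorm p (z - y)"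
proof -
  have "continuous_on K (\<lambda>x. pnorm p (x - y))"
    by (intro continuous_on_pnorm assms continuous_intros)
  from attains_Inf[OF assms(2,3) this] show ?thesis
    using that unfolding set_pdist_def by metis
qed

text \<open>Both hold because the minimum is attained. The non-strict form matches unions of closed
  balls, the strict form the open balls that appear after rounding.\<close>

lemma set_pdist_le_iff:
  assumes "1 \<le> p" "compact K" "K \<noteq> {}"
  shows "set_pdist p K y \<le> r \<longleftrightarrow> (\<exists>x\<in>K. pnorm p (x - y) \<le> r)"
    and "set_pdist p K y < r \<longleftrightarrow> (\<exists>x\<in>K. pnorm p (x - y) < r)"
proof -
  obtain x where "x \<in> K" "set_pdist p K y = pnorm p (x - y)"
    "\<And>z. z \<in> K \<Longrightarrow> pnorm p (x - y) \<le> pnorm p (z - y)"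
    using set_pdist_attained[OF assms] by metis
  then show "set_pdist p K y \<le> r \<longleftrightarrow> (\<exists>x\<in>K. pnorm p (x - y) \<le> r)"
    "set_pdist p K y < r \<longleftrightarrow> (\<exists>x\<in>K. pnorm p (x - y) < r)"
    by (metis order_trans, metis order_le_less_trans)
qed

text \<open>\<open>P \<subseteq> M\<close> gives one inequality. For the other, a nearest point of
  \<open>M\<close> is replaced by a sample point at distance less than
  \<open>\<delta>\<close>.\<close>

lemma set_pdist_near:
  assumes p: "1 \<le> p" and M: "compact M" and P: "finite P" "P \<noteq> {}" "P \<subseteq> M"
    and dense: "\<And>x. x \<in> M \<Longrightarrow> \<exists>z\<in>P. pnorm p (x - z) < \<delta>"
  shows "\<bar>set_pdist p P y - set_pdist p M y\<bar> \<le> \<delta>"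
proof -
  have M0: "M \<noteq> {}" using P by blast
  note PI = set_pdist_le_iff[OF p finite_imp_compact[OF P(1)] P(2)]
  obtain x where x: "x \<in> M" "set_pdist p M y = pnorm p (x - y)"
    using set_pdist_attained[OF p M M0] by metis
  obtain z where z: "z \<in> P" "pnorm p (x - z) < \<delta>" using dense[OF x(1)] by blast
  have "pnorm p (z - y) \<le> set_pdist p M y + \<delta>"
    using pnorm_triangle_diff[OF p, of z y x] pnorm_minus_commute[OF p, of z x] z(2) x(2) by simp
  then have "set_pdist p P y \<le> set_pdist p M y + \<delta>" using PI(1) z(1) by blast
  moreover have "set_pdist p M y \<le> set_pdist p P y"
    using PI(1)[of y "set_pdist p P y"] set_pdist_le_iff(1)[OF p M M0] P(3) by blast
  moreover have "0 \<le> \<delta>" using pnorm_nonneg[OF p, of "x - z"] z(2) by linarith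
  ultimately show ?thesis by linarith
qed

definition radius_at :: "ereal \<Rightarrow> (real ^ 'n) set \<Rightarrow> real ^ 'n \<Rightarrow> real" where
  "radius_at p F y = Max ((\<lambda>i. pnorm p (i - y)) ` F)"

text \<open>For finite nonempty \<open>F\<close>, the radius of a smallest \<open>p\<close>-norm
  ball enclosing \<open>F\<close>.\<close>

definition cech_radius :: "ereal \<Rightarrow> (real ^ 'n) set \<Rightarrow> real" where
  "cech_radius p F = Inf (range (radius_at p F))"

lemma radius_at_le_iff:
  assumes "finite F" "F \<noteq> {}"
  shows "radius_at p F y \<le> r \<longleftrightarrow> (\<forall>i\<in>F. pnorm p (i - y) \<le> r)"
    and "radius_at p F y < r \<longleftrightarrow> (\<forall>i\<in>F. pnorm p (i - y) < r)"
  using assms by (auto simp: radius_at_def)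

lemma continuous_on_Max_image:
  fixes f :: "'i \<Rightarrow> 'a::topological_space \<Rightarrow> real"
  assumes "finite F" "F \<noteq> {}" "\<And>i. i \<in> F \<Longrightarrow> continuous_on S (f i)"
  shows "continuous_on S (\<lambda>x. Max ((\<lambda>i. f i x) ` F))"
  using assms by (induction F rule: finite_ne_induct) (auto intro!: continuous_on_max)

lemma cech_radius_attained:
  assumes p: "1 \<le> p" and F: "finite F" "F \<noteq> {}"
  obtains y where "cech_radius p F = radius_at p F y" "\<And>z. radius_at p F y \<le> radius_at p F z"
proof -
  obtain i0 where i0: "i0 \<in> F" using F(2) by blast
  \<comment> \<open>A centre outside \<open>K\<close> is farther from \<open>i0\<close> than the
    radius already achieved with centre \<open>i0\<close>, so minimizing over this compact set is
    enough.\<close>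
  define K where "K = {y. pnorm p (i0 - y) \<le> radius_at p F i0}"
  have ge: "pnorm p (i0 - y) \<le> radius_at p F y" for y
    using radius_at_le_iff(1)[OF F, of p y "radius_at p F y"] i0 by simp
  have "compact K" unfolding K_def by (rule compact_pnorm_ball[OF p])
  moreover have "i0 \<in> K" using ge[of i0] by (simp add: K_def)
  moreover have "continuous_on K (radius_at p F)"
    unfolding radius_at_def by (intro continuous_on_Max_image F continuous_on_pnorm p continuous_intros)
  ultimately obtain y where y: "y \<in> K" "\<And>z. z \<in> K \<Longrightarrow> radius_at p F y \<le> radius_at p F z"
    using attains_Inf[of K "radius_at p F"] by blast
  have min: "radius_at p F y \<le> radius_at p F z" for z
  proof (cases "z \<in> K")
    case False
    then have "radius_at p F i0 \<le> radius_at p F z" using ge[of z] by (simp add: K_def)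
    then show ?thesis using y(2)[OF \<open>i0 \<in> K\<close>] by linarith
  qed (rule y)
  then have "cech_radius p F = radius_at p F y"
    unfolding cech_radius_def by (intro cInf_eq_minimum) auto
  then show ?thesis using min that by blast
qed

lemma cech_radius_le_iff:
  assumes p: "1 \<le> p" and F: "finite F" "F \<noteq> {}"
  shows "cech_radius p F \<le> r \<longleftrightarrow> (\<exists>y. \<forall>i\<in>F. pnorm p (i - y) \<le> r)"
    and "cech_radius p F < r \<longleftrightarrow> (\<exists>y. \<forall>i\<in>F. pnorm p (i - y) < r)"
proof -
  obtain y where y: "cech_radius p F = radius_at p F y" "\<And>z. radius_at p F y \<le> radius_at p F z"
    using cech_radius_attained[OF assms] by metis
  show "cech_radius p F \<le> r \<longleftrightarrow> (\<exists>y. \<forall>i\<in>F. pnorm p (i - y) \<le> r)"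
    unfolding y(1) radius_at_le_iff(1)[OF F, symmetric] using y(2) order_trans by blast
  show "cech_radius p F < r \<longleftrightarrow> (\<exists>y. \<forall>i\<in>F. pnorm p (i - y) < r)"
    unfolding y(1) radius_at_le_iff(2)[OF F, symmetric] using y(2) order_le_less_trans by blast
qed

text \<open>The least multiple of \<open>\<delta>\<close> strictly above \<open>v\<close>. Multiples
  of \<open>\<delta>\<close> are also moved, by a full step; this makes the inequality in
  \<open>round_up_le_iff\<close> strict.\<close>

definition round_up :: "real \<Rightarrow> real \<Rightarrow> real" where
  "round_up \<delta> v = \<delta> * (of_int \<lfloor>v / \<delta>\<rfloor> + 1)"

lemma round_up_le_iff:
  assumes "0 < \<delta>"
  shows "round_up \<delta> v \<le> r \<longleftrightarrow> v < \<delta> * of_int \<lfloor>r / \<delta>\<rfloor>"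
proof -
  have "round_up \<delta> v \<le> r \<longleftrightarrow> of_int (\<lfloor>v / \<delta>\<rfloor> + 1) \<le> r / \<delta>"
    using assms by (simp add: round_up_def pos_le_divide_eq mult.commute)
  also have "\<dots> \<longleftrightarrow> \<lfloor>v / \<delta>\<rfloor> < \<lfloor>r / \<delta>\<rfloor>"
    unfolding le_floor_iff[symmetric] by linarith
  also have "\<dots> \<longleftrightarrow> v / \<delta> < of_int \<lfloor>r / \<delta>\<rfloor>" by (rule floor_less_iff)
  also have "\<dots> \<longleftrightarrow> v < \<delta> * of_int \<lfloor>r / \<delta>\<rfloor>"
    using assms by (simp add: pos_divide_less_eq mult.commute)
  finally show ?thesis .
qed

lemma round_up_near:
  assumes "0 < \<delta>"
  shows "\<bar>round_up \<delta> v - v\<bar> \<le> \<delta>"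
proof -
  have "round_up \<delta> v - v = \<delta> * (of_int \<lfloor>v / \<delta>\<rfloor> + 1 - v / \<delta>)"
    using assms by (simp add: round_up_def algebra_simps)
  moreover have "\<bar>of_int \<lfloor>v / \<delta>\<rfloor> + 1 - v / \<delta>\<bar> \<le> 1" by linarith
  ultimately show ?thesis
    using assms mult_left_mono[of "\<bar>of_int \<lfloor>v / \<delta>\<rfloor> + 1 - v / \<delta>\<bar>" 1 \<delta>] by (simp add: abs_mult)
qed

section \<open>Positivity of the Hausdorff measure\<close>

text \<open>Continuous directional derivatives are bounded on a compact ball; bounds along a basis
  bound the operator norm, and the mean value inequality applies on the convex ball.\<close>

lemma lipschitz_near_if_smooth:
  fixes \<phi> :: "'a::euclidean_space \<Rightarrow> 'b::euclidean_space"
  assumes "smooth_map_on \<phi> U" "open U" "x \<in> U"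
  obtains r L where "0 < r" "0 < L" "cball x r \<subseteq> U"
    "\<And>y z. y \<in> cball x r \<Longrightarrow> z \<in> cball x r \<Longrightarrow> norm (\<phi> y - \<phi> z) \<le> L * norm (y - z)"
proof -
  define D where "D y = frechet_derivative \<phi> (at y)" for y
  have "Ck_on (Suc 0) \<phi> U" using assms(1) unfolding smooth_map_on_def by blast
  then have diff: "\<And>y. y \<in> U \<Longrightarrow> \<phi> differentiable (at y)" and cont: "\<And>v. continuous_on U (\<lambda>y. D y v)"
    by (auto simp: D_def)
  have der: "(\<phi> has_derivative D y) (at y)" if "y \<in> U" for y
    using diff[OF that] by (simp add: D_def frechet_derivative_works)
  obtain r where r: "0 < r" "cball x r \<subseteq> U"
    using assms(2,3) open_contains_cball by blast
  have "\<exists>C. \<forall>y\<in>cball x r. norm (D y b) \<le> C" for b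
  proof -
    have "compact ((\<lambda>y. D y b) ` cball x r)"
      using continuous_on_subset[OF cont r(2)] by (intro compact_continuous_image) auto
    from compact_imp_bounded[OF this] show ?thesis by (simp add: bounded_iff)
  qed
  then obtain C where C: "\<And>b y. y \<in> cball x r \<Longrightarrow> norm (D y b) \<le> C b" by metis
  have C0: "0 \<le> C b" for b
    using C[of x b] r(1) norm_ge_zero order_trans by (metis centre_in_cball less_imp_le)
  define L where "L = 1 + sum C Basis"
  have L: "0 < L" unfolding L_def using C0 by (simp add: add_pos_nonneg sum_nonneg)
  have "norm (\<phi> y - \<phi> z) \<le> L * norm (y - z)" if yz: "y \<in> cball x r" "z \<in> cball x r" for y z
  proof (rule differentiable_bound[where S = "cball x r" and f' = D])
    fix u assume u: "u \<in> cball x r"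
    show "(\<phi> has_derivative D u) (at u within cball x r)"
      using der r(2) u by (blast intro: has_derivative_at_withinI)
    have lin: "linear (D u)" using der u r(2) has_derivative_linear by blast
    show "onorm (D u) \<le> L"
    proof (rule onorm_le)
      fix v
      have "norm (D u v) = norm (\<Sum>b\<in>Basis. (v \<bullet> b) *\<^sub>R D u b)"
        using linear_sum[OF lin, of "\<lambda>b. (v \<bullet> b) *\<^sub>R b" Basis] linear_cmul[OF lin]
        by (simp add: euclidean_representation)
      also have "\<dots> \<le> (\<Sum>b\<in>Basis. norm v * C b)"
        using C[OF u] by (intro sum_norm_le) (auto intro!: mult_mono Basis_le_norm)
      also have "\<dots> = norm v * sum C Basis"
        by (rule sum_distrib_left[symmetric])
      also have "\<dots> \<le> L * norm v"
        by (simp add: L_def algebra_simps)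
      finally show "norm (D u v) \<le> L * norm v" .
    qed
  qed (use yz in auto)
  then show ?thesis using that r L by blast
qed

lemma hausdorff_outer_measure_mono:
  "A \<subseteq> B \<Longrightarrow> hausdorff_outer_measure k A \<le> hausdorff_outer_measure k B"
  unfolding hausdorff_outer_measure_def hausdorff_premeasure_def
  by (intro SUP_mono' INF_superset_mono) auto

text \<open>The range outside \<open>B\<close> is independent of \<open>c\<close>, so slabs with
  different centres share the same transverse factor and only the directions in \<open>B\<close>
  distinguish them.\<close>

definition slab :: "'a::euclidean_space set \<Rightarrow> 'a \<Rightarrow> real \<Rightarrow> 'a set" where
  "slab B c d = cbox (\<Sum>b\<in>Basis. (if b \<in> B then c \<bullet> b - d else -1) *\<^sub>R b)
                     (\<Sum>b\<in>Basis. (if b \<in> B then c \<bullet> b + d else 1) *\<^sub>R b)"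

lemma mem_slab:
  "v \<in> slab B c d \<longleftrightarrow> (\<forall>b\<in>Basis. if b \<in> B then \<bar>v \<bullet> b - c \<bullet> b\<bar> \<le> d else \<bar>v \<bullet> b\<bar> \<le> 1)"
  unfolding slab_def mem_box by (intro ball_cong) auto

lemma emeasure_slab:
  fixes B :: "'a::euclidean_space set"
  assumes "B \<subseteq> Basis" "0 \<le> d"
  shows "emeasure lborel (slab B c d) = ennreal (2 ^ DIM('a) * d ^ card B)"
proof -
  have "(\<Prod>b\<in>Basis. if b \<in> B then 2 * d else 2) = (\<Prod>b\<in>Basis. 2 * (if b \<in> B then d else 1))"
    by (intro prod.cong) auto
  also have "\<dots> = 2 ^ DIM('a) * d ^ card B"
    using assms(1) by (simp add: prod.distrib prod.If_cases Int_absorb1)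
  finally have *: "(\<Prod>b\<in>Basis. if b \<in> B then 2 * d else 2) = 2 ^ DIM('a) * d ^ card B" .
  have "emeasure lborel (slab B c d) = ennreal (\<Prod>b\<in>Basis. if b \<in> B then 2 * d else 2)"
    unfolding slab_def emeasure_lborel_cbox_eq
    using assms(2) by (auto simp: inner_diff_left intro!: arg_cong[where f = ennreal] prod.cong)
  then show ?thesis using * by simp
qed

text \<open>A cover of \<open>A\<close> induces a cover of the disk by images of diameter at most \<open>L\<close> times as large.
  Thickened by a unit cube in the remaining directions, the images lie in slabs, so that the
  Lebesgue measure of the thickened disk bounds the sum of the gauges.\<close>

lemma hausdorff_outer_measure_pos_coordinates:
  fixes h :: "'a::euclidean_space \<Rightarrow> 'b::euclidean_space"
  assumes B: "B \<subseteq> Basis" and L: "0 < L" and \<rho>: "0 < \<rho>" and w: "w \<in> span B"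
    and lip: "\<And>y z. y \<in> A \<Longrightarrow> z \<in> A \<Longrightarrow> norm (h y - h z) \<le> L * norm (y - z)"
    and cover: "span B \<inter> ball w \<rho> \<subseteq> h ` A"
  shows "0 < hausdorff_outer_measure (card B) A"
proof -
  define k where "k = card B"
  \<comment> \<open>Makes a cube of half-width \<open>\<rho>'\<close> fit into the ball of radius
    \<open>\<rho>\<close>: the l1 bound on the norm sums to \<open>\<rho> / 2\<close>.\<close>
  define \<rho>' where "\<rho>' = \<rho> / (2 * DIM('b))"
  have \<rho>': "0 < \<rho>'" using \<rho> by (simp add: \<rho>'_def)
  have finB: "finite B" using finite_subset[OF B finite_Basis] .
  \<comment> \<open>The ratio of the volume of the thickened disk to the factor in front of the
    gauges; the power of 2 cancels.\<close>
  define K where "K = (\<rho>' / L) ^ k"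
  have K: "0 < K" using \<rho>' L by (simp add: K_def)
  have bound: "ennreal K \<le> (\<Sum>i. hausdorff_gauge k (U i))"
    if U: "A \<subseteq> (\<Union>i. U i)" "\<And>i. bounded (U i)" for U :: "nat \<Rightarrow> 'a set"
  proof -
    \<comment> \<open>Centres of the slabs are images of points in \<open>A\<close>, since
      \<open>h\<close> is Lipschitz only there.\<close>
    define z where "z i = (SOME z. z \<in> U i \<inter> A)" for i
    have z: "z i \<in> U i \<inter> A" if "U i \<inter> A \<noteq> {}" for i
      unfolding z_def using that by (metis some_in_eq)
    define W where "W i = (if U i \<inter> A = {} then {} else slab B (h (z i)) (L * diameter (U i)))" for i
    have diam: "0 \<le> diameter (U i)" for i using diameter_ge_0[OF U(2)] .
    have "slab B w \<rho>' \<subseteq> (\<Union>i. W i)"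
    proof
      fix v assume v: "v \<in> slab B w \<rho>'"
      \<comment> \<open>The projection of \<open>v\<close> to \<open>span B\<close>: it lies in the
        disk, hence is the image of a point of \<open>A\<close>, and has the same coordinates in
        \<open>B\<close> as \<open>v\<close>.\<close>
      define v' where "v' = (\<Sum>b\<in>B. (v \<bullet> b) *\<^sub>R b)"
      have v'_span: "v' \<in> span B" unfolding v'_def by (intro span_sum span_scale span_base)
      have v'_B: "v' \<bullet> b = v \<bullet> b" if "b \<in> B" for b
      proof -
        have "v' \<bullet> b = (\<Sum>a\<in>B. if a = b then v \<bullet> a else 0)"
          unfolding v'_def inner_sum_left using B that
          by (intro sum.cong) (auto simp: inner_Basis subset_iff)
        then show ?thesis using that finB by simp
      qed
      have span_0: "u \<bullet> b = 0" if "u \<in> span B" "b \<in> Basis - B" for u b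
        using that(1) by (induction rule: span_induct)
          (use that(2) B in \<open>auto simp: subspace_def inner_left_distrib inner_Basis subset_iff\<close>)
      have "\<bar>(v' - w) \<bullet> b\<bar> \<le> \<rho>'" if b: "b \<in> Basis" for b
      proof (cases "b \<in> B")
        case True
        then show ?thesis using v b v'_B[OF True] by (auto simp: mem_slab inner_diff_left split: if_splits)
      next
        case False
        then show ?thesis using span_0[OF v'_span] span_0[OF w] b \<rho>' by (simp add: inner_diff_left)
      qed
      then have "norm (v' - w) \<le> (\<Sum>b\<in>(Basis::'b set). \<rho>')"
        by (intro order_trans[OF norm_le_l1] sum_mono)
      also have "\<dots> < \<rho>" using \<rho> by (simp add: \<rho>'_def)
      finally have "v' \<in> ball w \<rho>" by (simp add: dist_norm norm_minus_commute)
      then obtain u where u: "u \<in> A" "v' = h u" using cover v'_span by blast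
      obtain i where i: "u \<in> U i" using u U(1) by blast
      have ne: "U i \<inter> A \<noteq> {}" using u i by blast
      have "norm (u - z i) \<le> diameter (U i)"
        using diameter_bounded_bound[OF U(2) i, of "z i"] z[OF ne] by (simp add: dist_norm)
      then have le: "norm (v' - h (z i)) \<le> L * diameter (U i)"
        using lip[OF u(1), of "z i"] z[OF ne] u(2) L by (smt (verit) IntD2 mult_left_mono)
      have "\<bar>v \<bullet> b - h (z i) \<bullet> b\<bar> \<le> L * diameter (U i)" if "b \<in> Basis" "b \<in> B" for b
        using le Basis_le_norm[OF that(1), of "v' - h (z i)"] v'_B[OF that(2)] by (simp add: inner_diff_left)
      then have "v \<in> W i" using ne v by (auto simp: W_def mem_slab)
      then show "v \<in> (\<Union>i. W i)" by blast
    qed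
    then have "emeasure lborel (slab B w \<rho>') \<le> emeasure lborel (\<Union>i. W i)"
      by (intro emeasure_mono) (auto simp: W_def slab_def)
    also have "\<dots> \<le> (\<Sum>i. emeasure lborel (W i))"
      by (intro emeasure_subadditive_countably) (auto simp: W_def slab_def)
    also have "\<dots> \<le> (\<Sum>i. ennreal (2 ^ DIM('b) * L ^ k) * hausdorff_gauge k (U i))"
    proof (intro suminf_le summableI)
      fix i
      show "emeasure lborel (W i) \<le> ennreal (2 ^ DIM('b) * L ^ k) * hausdorff_gauge k (U i)"
        using emeasure_slab[OF B, of "L * diameter (U i)" "h (z i)"] L diam[of i]
        by (auto simp: W_def hausdorff_gauge_def k_def power_mult_distrib mult.assoc simp flip: ennreal_mult)
    qed
    also have "\<dots> = ennreal (2 ^ DIM('b) * L ^ k) * (\<Sum>i. hausdorff_gauge k (U i))"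
      by (simp add: ennreal_suminf_cmult)
    finally have "ennreal (2 ^ DIM('b) * \<rho>' ^ k) \<le> ennreal (2 ^ DIM('b) * L ^ k) * (\<Sum>i. hausdorff_gauge k (U i))"
      using emeasure_slab[OF B, of \<rho>' w] \<rho>' by (simp add: k_def)
    moreover have "ennreal (2 ^ DIM('b) * \<rho>' ^ k) = ennreal (2 ^ DIM('b) * L ^ k) * ennreal K"
      using L \<rho>' by (simp add: K_def power_divide flip: ennreal_mult)
    ultimately have "ennreal (2 ^ DIM('b) * L ^ k) * ennreal K
        \<le> ennreal (2 ^ DIM('b) * L ^ k) * (\<Sum>i. hausdorff_gauge k (U i))"
      by metis
    then show ?thesis
      using L by (subst (asm) ennreal_mult_le_mult_iff) (auto simp: ennreal_eq_0_iff not_le)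
  qed
  \<comment> \<open>The bound ignores the mesh of the cover, so any scale would do; 1 is an
    arbitrary choice.\<close>
  have "ennreal K \<le> hausdorff_premeasure k 1 A"
    unfolding hausdorff_premeasure_def by (intro INF_greatest) (use bound in auto)
  also have "\<dots> \<le> hausdorff_outer_measure k A"
    unfolding hausdorff_outer_measure_def by (intro SUP_upper) simp
  finally show ?thesis using K by (simp add: k_def less_le_trans[OF _ \<open>ennreal K \<le> _\<close>] order.strict_trans2[of 0 "ennreal K"])
qed

text \<open>A linear isometry carries \<open>S\<close> onto a coordinate subspace, where slabs are
  boxes parallel to the axes.\<close>

lemma hausdorff_outer_measure_pos:
  fixes f :: "'a::euclidean_space \<Rightarrow> 'b::euclidean_space"
  assumes S: "subspace S" and L: "0 < L" and \<rho>: "0 < \<rho>" and w: "w \<in> S"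
    and lip: "\<And>y z. y \<in> A \<Longrightarrow> z \<in> A \<Longrightarrow> norm (f y - f z) \<le> L * norm (y - z)"
    and fS: "f ` A \<subseteq> S" and cover: "S \<inter> ball w \<rho> \<subseteq> f ` A"
  shows "0 < hausdorff_outer_measure (dim S) A"
proof -
  have "dim S \<le> card (Basis :: 'b set)" using dim_subset_UNIV[of S] by simp
  then obtain B where B: "B \<subseteq> (Basis :: 'b set)" "card B = dim S"
    using obtain_subset_with_card_n by metis
  have "dim (span B) = dim S"
    using B dim_eq_card_independent[OF independent_mono[OF independent_Basis B(1)]] by simp
  then obtain g where g: "linear g" "g ` S = span B" "\<And>x. x \<in> S \<Longrightarrow> norm (g x) = norm x"
    using isometry_subspaces[OF S subspace_span, of B] by metis
  have dist_g: "norm (g x - g y) = norm (x - y)" if "x \<in> S" "y \<in> S" for x y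
    using g(3)[OF subspace_diff[OF S that]] linear_diff[OF g(1)] by metis
  have "0 < hausdorff_outer_measure (card B) A"
  proof (rule hausdorff_outer_measure_pos_coordinates[OF B(1) L \<rho>])
    show "g w \<in> span B" using g(2) w by blast
    show "norm ((g \<circ> f) y - (g \<circ> f) z) \<le> L * norm (y - z)" if "y \<in> A" "z \<in> A" for y z
    proof -
      have "f y \<in> S" "f z \<in> S" using fS that by auto
      then show ?thesis using lip[OF that] dist_g by simp
    qed
    show "span B \<inter> ball (g w) \<rho> \<subseteq> (g \<circ> f) ` A"
    proof
      fix v assume v: "v \<in> span B \<inter> ball (g w) \<rho>"
      then obtain x where x: "x \<in> S" "v = g x" using g(2) by blast
      then have "x \<in> ball w \<rho>" using v dist_g[OF w x(1)] by (simp add: dist_norm)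
      then show "v \<in> (g \<circ> f) ` A" using cover x by auto
    qed
  qed
  then show ?thesis by (simp add: B(2))
qed

text \<open>A slice chart is Lipschitz near \<open>x\<close> and maps a small piece of
  \<open>M\<close> onto a set containing a \<open>k\<close>-dimensional disk.\<close>

lemma hausdorff_outer_measure_submanifold_ball_pos:
  fixes M :: "'a::euclidean_space set"
  assumes M: "smooth_submanifold k M" and x: "x \<in> M" and \<delta>: "0 < \<delta>"
  shows "0 < hausdorff_outer_measure k (M \<inter> ball x \<delta>)"
proof -
  obtain U V \<phi> \<psi> S where ch: "open U" "x \<in> U" "open V" "smooth_map_on \<phi> U" "smooth_map_on \<psi> V"
      "\<phi> ` U = V" "\<And>u. u \<in> U \<Longrightarrow> \<psi> (\<phi> u) = u" "\<And>v. v \<in> V \<Longrightarrow> \<phi> (\<psi> v) = v"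
      "subspace S" "dim S = k" "\<phi> ` (U \<inter> M) = (V \<inter> S :: 'a set)"
    using M x unfolding smooth_submanifold_def by metis
  obtain r L where r: "0 < r" "0 < L" "cball x r \<subseteq> U"
    "\<And>y z. y \<in> cball x r \<Longrightarrow> z \<in> cball x r \<Longrightarrow> norm (\<phi> y - \<phi> z) \<le> L * norm (y - z)"
    by (rule lipschitz_near_if_smooth[OF ch(4,1,2)]) (blast intro: that)
  define s where "s = min r \<delta>"
  define A where "A = M \<inter> ball x s"
  have AU: "A \<subseteq> U \<inter> M" "A \<subseteq> cball x r" using r(3) by (auto simp: A_def s_def)
  \<comment> \<open>Continuity of the inverse chart supplies the disk: points of \<open>V\<close>
    near \<open>\<phi> x\<close> come from points near \<open>x\<close>.\<close>
  have "Ck_on 0 \<psi> V" using ch(5) unfolding smooth_map_on_def by blast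
  then have "open (V \<inter> \<psi> -` ball x s)"
    using ch(3) by (intro continuous_open_preimage) auto
  moreover have "\<phi> x \<in> V \<inter> \<psi> -` ball x s"
    using ch(2,6,7) r(1) \<delta> by (auto simp: s_def)
  ultimately obtain \<rho> where \<rho>: "0 < \<rho>" "ball (\<phi> x) \<rho> \<subseteq> V \<inter> \<psi> -` ball x s"
    by (meson openE)
  have "0 < hausdorff_outer_measure (dim S) A"
  proof (rule hausdorff_outer_measure_pos[OF ch(9) r(2) \<rho>(1)])
    show "\<phi> x \<in> S" using ch(2,11) x by blast
    show "norm (\<phi> y - \<phi> z) \<le> L * norm (y - z)" if "y \<in> A" "z \<in> A" for y z
      using r(4) AU that by blast
    show "\<phi> ` A \<subseteq> S" using AU ch(11) by blast
    show "S \<inter> ball (\<phi> x) \<rho> \<subseteq> \<phi> ` A"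
    proof
      fix v assume v: "v \<in> S \<inter> ball (\<phi> x) \<rho>"
      then obtain u where u: "u \<in> U \<inter> M" "v = \<phi> u" using \<rho>(2) ch(11) by blast
      then have "u \<in> ball x s" using v \<rho>(2) ch(7)[of u] by auto
      then show "v \<in> \<phi> ` A" using u by (auto simp: A_def)
    qed
  qed
  also have "\<dots> \<le> hausdorff_outer_measure k (M \<inter> ball x \<delta>)"
    unfolding ch(10) by (rule hausdorff_outer_measure_mono) (auto simp: A_def s_def)
  finally show ?thesis .
qed

section \<open>Density of large samples\<close>

lemma space_normalized_hausdorff_measure [simp]: "space (normalized_hausdorff_measure k M) = M"
  and sets_normalized_hausdorff_measure [simp]:
    "sets (normalized_hausdorff_measure k M) = sets (restrict_space borel M)"
proof -
  have "sets (restrict_space borel M) \<subseteq> Pow M"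
    using sets.sets_into_space[of _ "restrict_space borel M"] by (auto simp: space_restrict_space)
  moreover have "sigma_sets M (sets (restrict_space borel M)) = sets (restrict_space borel M)"
    using sets.sigma_sets_eq[of "restrict_space borel M"] by (simp add: space_restrict_space)
  ultimately show "space (normalized_hausdorff_measure k M) = M"
    "sets (normalized_hausdorff_measure k M) = sets (restrict_space borel M)"
    by (simp_all add: normalized_hausdorff_measure_def)
qed

text \<open>The set function need not be countably additive a priori, in which case \<^const>\<open>measure_of\<close> is the
  zero measure. A probability space excludes this, and also that the total mass is \<open>0\<close> or \<open>\<infinity>\<close>.\<close>

lemma emeasure_normalized_hausdorff_measure_pos:
  fixes M A :: "'a::metric_space set"
  assumes prob: "prob_space (normalized_hausdorff_measure k M)"
    and A: "A \<in> sets (normalized_hausdorff_measure k M)" and pos: "0 < hausdorff_outer_measure k A"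
  shows "0 < emeasure (normalized_hausdorff_measure k M) A"
proof -
  interpret prob_space "normalized_hausdorff_measure k M" by fact
  define F :: "'a set \<Rightarrow> ennreal" where "F A = hausdorff_outer_measure k A / hausdorff_outer_measure k M" for A
  have conv: "emeasure (normalized_hausdorff_measure k M) B =
      (if B \<in> sigma_sets M (sets (restrict_space borel M)) \<and>
          measure_space M (sigma_sets M (sets (restrict_space borel M))) F then F B else 0)" for B
    unfolding normalized_hausdorff_measure_def F_def by (subst emeasure_measure_of_conv) (rule refl)
  have one: "emeasure (normalized_hausdorff_measure k M) M = 1"
    using emeasure_space_1 by simp
  then have ms: "measure_space M (sigma_sets M (sets (restrict_space borel M))) F" and "F M = 1"
    unfolding conv by (simp_all split: if_splits)
  have "hausdorff_outer_measure k M \<noteq> top"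
    using \<open>F M = 1\<close> by (auto simp: F_def divide_ennreal_def)
  moreover have "A \<in> sigma_sets M (sets (restrict_space borel M))" using A by (simp add: sigma_sets.Basic)
  ultimately show ?thesis
    using conv[of A] ms pos by (auto simp: F_def ennreal_zero_less_divide less_top)
qed

text \<open>The law of the first sample point is \<open>\<mu>\<close>. This is how finiteness and
  positivity of the total Hausdorff measure become available.\<close>

lemma prob_space_sample_law:
  assumes "1 \<le> m" "iid_sample \<Omega> \<mu> m X"
  shows "prob_space \<mu>"
proof -
  interpret prob_space \<Omega> using assms(2) by (simp add: iid_sample_def)
  have "indep_vars (\<lambda>_. \<mu>) X {..<m}" "distr \<Omega> \<mu> (X 0) = \<mu>"
    using assms by (auto simp: iid_sample_def)
  then have "random_variable \<mu> (X 0)" using assms(1) unfolding indep_vars_def2 by auto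
  from prob_space_distr[OF this] show ?thesis using \<open>distr \<Omega> \<mu> (X 0) = \<mu>\<close> by simp
qed

lemma sample_set_in_space:
  assumes "iid_sample \<Omega> \<mu> m X" "\<omega> \<in> space \<Omega>"
  shows "sample_set m X \<omega> \<subseteq> space \<mu>"
proof -
  interpret prob_space \<Omega> using assms(1) by (simp add: iid_sample_def)
  have "X i \<in> measurable \<Omega> \<mu>" if "i < m" for i
    using assms(1) that unfolding iid_sample_def indep_vars_def2 by auto
  then show ?thesis using assms(2) by (auto simp: sample_set_def dest: measurable_space)
qed

text \<open>Avoiding \<open>A\<close> means that all \<open>m\<close> points lie in its complement;
  independence turns this into a product of equal factors.\<close>

lemma emeasure_sample_avoids:
  assumes iid: "iid_sample \<Omega> \<mu> m X" and m: "1 \<le> m" and A: "A \<in> sets \<mu>"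
  shows "{\<omega> \<in> space \<Omega>. sample_set m X \<omega> \<inter> A = {}} \<in> sets \<Omega>"
    and "emeasure \<Omega> {\<omega> \<in> space \<Omega>. sample_set m X \<omega> \<inter> A = {}} = ennreal ((1 - measure \<mu> A) ^ m)"
proof -
  interpret prob_space \<Omega> using iid by (simp add: iid_sample_def)
  interpret \<mu>: prob_space \<mu> by (rule prob_space_sample_law[OF m iid])
  have indep: "indep_sets (\<lambda>i. {X i -` A \<inter> space \<Omega> |A. A \<in> sets \<mu>}) {..<m}"
    and meas: "\<And>i. i < m \<Longrightarrow> X i \<in> measurable \<Omega> \<mu>"
    and dist: "\<And>i. i < m \<Longrightarrow> distr \<Omega> \<mu> (X i) = \<mu>"
    using iid unfolding iid_sample_def indep_vars_def2 by auto
  define C where "C = space \<mu> - A"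
  have C: "C \<in> sets \<mu>" using A by (simp add: C_def)
  have ne: "{..<m} \<noteq> {}" using m by (simp add: lessThan_empty_iff)
  have eq: "{\<omega> \<in> space \<Omega>. sample_set m X \<omega> \<inter> A = {}} = (\<Inter>i\<in>{..<m}. X i -` C \<inter> space \<Omega>)"
  proof -
    have "X i \<omega> \<in> space \<mu>" if "i < m" "\<omega> \<in> space \<Omega>" for i \<omega>
      using measurable_space[OF meas[OF that(1)] that(2)] .
    moreover have "0 \<in> {..<m}" using m by simp
    ultimately show ?thesis by (auto simp: sample_set_def C_def)
  qed
  show "{\<omega> \<in> space \<Omega>. sample_set m X \<omega> \<inter> A = {}} \<in> sets \<Omega>"
    unfolding eq using ne meas C by (intro sets.finite_INT) (auto simp: measurable_sets)
  have "prob (\<Inter>i\<in>{..<m}. X i -` C \<inter> space \<Omega>) = (\<Prod>i<m. prob (X i -` C \<inter> space \<Omega>))"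
    using ne C by (intro indep_setsD[OF indep]) auto
  also have "\<dots> = (\<Prod>i<m. 1 - measure \<mu> A)"
  proof (rule prod.cong)
    fix i assume "i \<in> {..<m}"
    then have "prob (X i -` C \<inter> space \<Omega>) = measure \<mu> C"
      using measure_distr[OF meas C, of i] dist[of i] by simp
    then show "prob (X i -` C \<inter> space \<Omega>) = 1 - measure \<mu> A"
      unfolding C_def using \<mu>.prob_compl[OF A] by simp
  qed simp
  finally show "emeasure \<Omega> {\<omega> \<in> space \<Omega>. sample_set m X \<omega> \<inter> A = {}} = ennreal ((1 - measure \<mu> A) ^ m)"
    unfolding eq by (simp add: emeasure_eq_measure)
qed

text \<open>The event of a sparse sample is contained in a finite union of measurable events, one
  for each ball of the cover that the sample misses; each has probability \<open>q ^ m\<close> with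
  \<open>q < 1\<close>.\<close>

lemma sample_becomes_dense:
  fixes M :: "'a::euclidean_space set"
  assumes M: "compact M"
    and iid: "\<And>m. 1 \<le> m \<Longrightarrow> iid_sample (\<Omega> m) \<mu> m (X m)"
    and \<mu>: "space \<mu> = M" "sets \<mu> = sets (restrict_space borel M)"
    and pos: "\<And>x r. x \<in> M \<Longrightarrow> 0 < r \<Longrightarrow> 0 < emeasure \<mu> (M \<inter> ball x r)"
    and \<eta>: "0 < \<eta>"
  shows "(\<lambda>m. outer_measure_of (\<Omega> m)
            {\<omega> \<in> space (\<Omega> m). \<not> (\<forall>x\<in>M. \<exists>y\<in>sample_set m (X m) \<omega>. dist x y < \<eta>)}) \<longlonglongrightarrow> 0"
proof -
  interpret \<mu>: prob_space \<mu>
    by (rule prob_space_sample_law[OF _ iid[of 1]]) auto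
  obtain C where C: "finite C" "C \<subseteq> M" "M \<subseteq> (\<Union>c\<in>C. ball c (\<eta> / 2))"
    using compactE_image[OF M, of M "\<lambda>c. ball c (\<eta> / 2)"] \<eta> by (metis UN_I centre_in_ball half_gt_zero open_ball subsetI)
  define A where "A c = M \<inter> ball c (\<eta> / 2)" for c
  have A: "A c \<in> sets \<mu>" for c
    unfolding \<mu>(2) A_def sets_restrict_space by auto
  have q: "0 < measure \<mu> (A c)" "measure \<mu> (A c) \<le> 1" if "c \<in> C" for c
    using pos[of c "\<eta> / 2"] C(2) that \<eta> by (auto simp: A_def \<mu>.emeasure_eq_measure)
  define B where "B m = (\<Union>c\<in>C. {\<omega> \<in> space (\<Omega> m). sample_set m (X m) \<omega> \<inter> A c = {}})" for m
  have le: "outer_measure_of (\<Omega> m) {\<omega> \<in> space (\<Omega> m). \<not> (\<forall>x\<in>M. \<exists>y\<in>sample_set m (X m) \<omega>. dist x y < \<eta>)}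
      \<le> ennreal (\<Sum>c\<in>C. (1 - measure \<mu> (A c)) ^ m)" if m: "1 \<le> m" for m
  proof -
    have "{\<omega> \<in> space (\<Omega> m). \<not> (\<forall>x\<in>M. \<exists>y\<in>sample_set m (X m) \<omega>. dist x y < \<eta>)} \<subseteq> B m"
    proof
      fix \<omega> assume "\<omega> \<in> {\<omega> \<in> space (\<Omega> m). \<not> (\<forall>x\<in>M. \<exists>y\<in>sample_set m (X m) \<omega>. dist x y < \<eta>)}"
      then obtain x where x: "\<omega> \<in> space (\<Omega> m)" "x \<in> M" "\<And>y. y \<in> sample_set m (X m) \<omega> \<Longrightarrow> \<not> dist x y < \<eta>"
        by blast
      obtain c where c: "c \<in> C" "dist c x < \<eta> / 2" using C(3) x(2) by auto
      have "sample_set m (X m) \<omega> \<inter> A c = {}"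
      proof (rule ccontr)
        assume "sample_set m (X m) \<omega> \<inter> A c \<noteq> {}"
        then obtain y where "y \<in> sample_set m (X m) \<omega>" "dist c y < \<eta> / 2" by (auto simp: A_def)
        then show False using x(3)[of y] dist_triangle_half_r[OF c(2), of y] by blast
      qed
      then show "\<omega> \<in> B m" using x(1) c(1) by (auto simp: B_def)
    qed
    then have "outer_measure_of (\<Omega> m) {\<omega> \<in> space (\<Omega> m). \<not> (\<forall>x\<in>M. \<exists>y\<in>sample_set m (X m) \<omega>. dist x y < \<eta>)}
        \<le> outer_measure_of (\<Omega> m) (B m)"
      by (rule outer_measure_of_mono)
    also have "\<dots> = emeasure (\<Omega> m) (B m)"
      unfolding B_def using emeasure_sample_avoids(1)[OF iid[OF m] m A] C(1)
      by (intro outer_measure_of_eq sets.finite_UN) auto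
    also have "\<dots> \<le> (\<Sum>c\<in>C. emeasure (\<Omega> m) {\<omega> \<in> space (\<Omega> m). sample_set m (X m) \<omega> \<inter> A c = {}})"
      unfolding B_def using emeasure_sample_avoids(1)[OF iid[OF m] m A] C(1)
      by (intro emeasure_subadditive_finite) auto
    also have "\<dots> = (\<Sum>c\<in>C. ennreal ((1 - measure \<mu> (A c)) ^ m))"
      using emeasure_sample_avoids(2)[OF iid[OF m] m A] by simp
    also have "\<dots> = ennreal (\<Sum>c\<in>C. (1 - measure \<mu> (A c)) ^ m)"
      using q by (intro sum_ennreal) auto
    finally show ?thesis .
  qed
  have "(\<lambda>m. \<Sum>c\<in>C. (1 - measure \<mu> (A c)) ^ m) \<longlonglongrightarrow> (\<Sum>c\<in>C. 0)"
    using q by (intro tendsto_sum LIMSEQ_realpow_zero) auto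
  then have lim: "(\<lambda>m. ennreal (\<Sum>c\<in>C. (1 - measure \<mu> (A c)) ^ m)) \<longlonglongrightarrow> 0"
    using tendsto_ennrealI[of _ 0] by simp
  have "\<forall>\<^sub>F m in sequentially. outer_measure_of (\<Omega> m)
      {\<omega> \<in> space (\<Omega> m). \<not> (\<forall>x\<in>M. \<exists>y\<in>sample_set m (X m) \<omega>. dist x y < \<eta>)}
      \<le> ennreal (\<Sum>c\<in>C. (1 - measure \<mu> (A c)) ^ m)"
    using eventually_ge_at_top[of 1] by eventually_elim (rule le)
  then show ?thesis
    by (rule tendsto_sandwich[OF _ _ tendsto_const lim, rotated]) simp
qed

section \<open>Comparison of the filtrations\<close>

text \<open>The product of the two point types fits into the second one; \<^const>\<open>arctan\<close> has values in \<open>(-2, 2)\<close>,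
  so the entry exceeding \<open>2\<close> marks the first component.\<close>

definition pair_code :: "'a \<times> ('a \<Rightarrow> real) \<Rightarrow> 'a \<Rightarrow> real" where
  "pair_code = (\<lambda>(y, a) z. arctan (a z) + (if z = y then 10 else 0))"

lemma inj_pair_code: "inj (pair_code :: 'a \<times> ('a \<Rightarrow> real) \<Rightarrow> 'a \<Rightarrow> real)"
proof (rule injI)
  fix u v :: "'a \<times> ('a \<Rightarrow> real)"
  assume eq: "pair_code u = pair_code v"
  obtain y a y' a' where uv: "u = (y, a)" "v = (y', a')" by fastforce
  have eq': "arctan (a z) + (if z = y then 10 else 0) = arctan (a' z) + (if z = y' then 10 else 0)" for z
    using fun_cong[OF eq, of z] by (simp add: pair_code_def uv)
  have "y = y'"
    using eq'[of y] arctan_bounded[of "a y"] arctan_bounded[of "a' y"] pi_less_4 by (auto split: if_splits)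
  moreover have "a z = a' z" for z
    using eq'[of z] \<open>y = y'\<close> arctan_eq_iff[of "a z" "a' z"] by (simp split: if_splits)
  ultimately show "u = v" by (auto simp: uv)
qed

lemma sup_distance_le:
  "(\<And>x. \<bar>\<gamma> x - \<kappa> x\<bar> \<le> c) \<Longrightarrow> sup_distance T \<gamma> \<kappa> \<le> ennreal c"
  unfolding sup_distance_def by (intro SUP_least ennreal_leI)

text \<open>Rewrites a filtration given by explicit spaces as a sublevel filtration, the form to
  which stability applies.\<close>

lemma transport_rspace_cong:
  assumes e: "inj e" and X: "metrizable_space X"
    and obj: "\<And>r. obj Y r = subtopology X {x. \<gamma> x \<le> r}" and arr: "\<And>r s. arr Y r s = (\<lambda>x. x)"
  shows "is_rspace (transport_rspace e Y)"
    "weakly_equivalent (transport_rspace e Y) (sublevel_rspace (transport_topology e X) (\<gamma> \<circ> inv e))"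
proof -
  have obj': "rspace.obj (transport_rspace e Y) r
      = rspace.obj (sublevel_rspace (transport_topology e X) (\<gamma> \<circ> inv e)) r" for r
    unfolding obj_sublevel_transport[OF e X]
    by (simp add: transport_rspace_def transport_topology_def obj)
  have "arr (transport_rspace e Y) r s u = arr (sublevel_rspace (transport_topology e X) (\<gamma> \<circ> inv e)) r s u"
    if "u \<in> topspace (rspace.obj (sublevel_rspace (transport_topology e X) (\<gamma> \<circ> inv e)) r)" for r s u
    using that e unfolding obj_sublevel_transport[OF e X] topspace_transport_topology[OF e]
    by (auto simp: transport_rspace_def sublevel_rspace_def arr)
  note cong = rspace_cong[OF is_rspace_sublevel[OF metrizable_transport_topology[OF e X]] obj' this]
  show "is_rspace (transport_rspace e Y)"
    "weakly_equivalent (transport_rspace e Y) (sublevel_rspace (transport_topology e X) (\<gamma> \<circ> inv e))"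
    by (rule cong; assumption)+
qed

text \<open>Stability is used twice, on the simplex and on Euclidean space; the two rounded
  filtrations in between are joined by the zigzag through the blow-up.\<close>

lemma cech_offset_distance:
  fixes p :: ereal and M P :: "(real ^ 'n) set" and d :: "'u rspace \<Rightarrow> 'u rspace \<Rightarrow> ennreal"
    and e\<^sub>1 :: "real ^ 'n \<Rightarrow> 'u" and e\<^sub>2 :: "(real ^ 'n \<Rightarrow> real) \<Rightarrow> 'u"
  assumes p: "1 \<le> p" and M: "compact M" and P: "finite P" "P \<noteq> {}" "P \<subseteq> M" and \<delta>: "0 < \<delta>"
    and dense: "\<And>x. x \<in> M \<Longrightarrow> \<exists>z\<in>P. pnorm p (x - z) < \<delta>"
    and e: "inj e\<^sub>1" "inj e\<^sub>2"
    and d: "rspace_distance d" "stable_distance d" "homotopy_invariant_distance d"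
  shows "d (transport_rspace e\<^sub>2 (cech p P)) (transport_rspace e\<^sub>1 (offset p M)) \<le> ennreal (3 * \<delta>)"
proof -
  define \<Delta> where "\<Delta> = closed_simplex P"
  define supp where "supp a = {i :: real ^ 'n. a i \<noteq> (0::real)}" for a
  have supp: "finite (supp a)" "supp a \<noteq> {}" if "a \<in> \<Delta>" for a
  proof -
    have "supp a \<subseteq> P" using closed_simplex_support that by (auto simp: supp_def \<Delta>_def)
    then show "finite (supp a)" using P(1) finite_subset by blast
    show "supp a \<noteq> {}" using closed_simplex_nonzero[of a P] that by (auto simp: supp_def \<Delta>_def)
  qed
  define \<gamma> where "\<gamma> a = cech_radius p (supp a)" for a
  \<comment> \<open>The filtration function of the blow-up: the least radius at which
    \<open>y\<close> lies in all closed balls around the support of \<open>a\<close>.\<close>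
  define \<zeta> where "\<zeta> = (\<lambda>(y, a). radius_at p (supp a) y)"
  \<comment> \<open>Places the middle term of the zigzag in \<open>'u\<close>, since homotopy
    invariance of \<open>d\<close> speaks only of spaces there.\<close>
  define e\<^sub>3 where "e\<^sub>3 = e\<^sub>2 \<circ> pair_code"
  have e3: "inj e\<^sub>3" unfolding e\<^sub>3_def using e(2) inj_pair_code by (rule inj_compose)
  define X\<^sub>1 X\<^sub>2 X\<^sub>3 where "X\<^sub>1 = (euclidean :: (real ^ 'n) topology)"
    and "X\<^sub>2 = top_of_set \<Delta>" and "X\<^sub>3 = top_of_set ((UNIV :: (real ^ 'n) set) \<times> \<Delta>)"
  have X1: "metrizable_space X\<^sub>1" and X2: "metrizable_space X\<^sub>2"
    unfolding X\<^sub>1_def X\<^sub>2_def \<Delta>_def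
    by (rule metrizable_space_euclidean, rule metrizable_space_closed_simplex[OF P(1)])
  have "X\<^sub>3 = prod_topology X\<^sub>1 X\<^sub>2"
    using prod_topology_subtopology_eu[of "UNIV :: (real ^ 'n) set" \<Delta>]
    by (simp add: X\<^sub>1_def X\<^sub>2_def X\<^sub>3_def)
  then have X3: "metrizable_space X\<^sub>3" using X1 X2 by (simp add: metrizable_space_prod_topology)
  let ?h = "round_up \<delta>"
  let ?\<rho> = "\<lambda>r. \<delta> * of_int \<lfloor>r / \<delta>\<rfloor>"
  let ?B = "\<lambda>r i. {y. pnorm p (i - y) < ?\<rho> r}"
  let ?S = "\<lambda>e X \<gamma>. sublevel_rspace (transport_topology e X) (\<gamma> \<circ> inv e)"
  note P_iff = set_pdist_le_iff[OF p finite_imp_compact[OF P(1)] P(2)]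

  have sub1: "subtopology X\<^sub>1 {y. (?h \<circ> set_pdist p P) y \<le> r} = top_of_set (\<Union>i\<in>P. ?B r i)" for r
  proof -
    have "{y. (?h \<circ> set_pdist p P) y \<le> r} = (\<Union>i\<in>P. ?B r i)"
      using P_iff(2) by (auto simp: round_up_le_iff[OF \<delta>])
    then show ?thesis by (simp add: X\<^sub>1_def)
  qed
  have sub2: "subtopology X\<^sub>2 {a. (?h \<circ> \<gamma>) a \<le> r} = top_of_set (realization_points (nerve P (?B r)))" for r
  proof -
    have "\<Delta> \<inter> {a. (?h \<circ> \<gamma>) a \<le> r} = realization_points (nerve P (?B r))"
      unfolding realization_points_nerve[OF P(1)]
      using cech_radius_le_iff(2)[OF p supp]
      by (auto simp: round_up_le_iff[OF \<delta>] \<gamma>_def \<Delta>_def supp_def)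
    then show ?thesis by (simp add: X\<^sub>2_def subtopology_subtopology)
  qed
  have sub3: "subtopology X\<^sub>3 {z. (?h \<circ> \<zeta>) z \<le> r} = top_of_set (nerve_total P (?B r))" for r
  proof -
    have "(UNIV \<times> \<Delta>) \<inter> {z. (?h \<circ> \<zeta>) z \<le> r} = nerve_total P (?B r)"
      using radius_at_le_iff(2)[OF supp]
      by (auto simp: nerve_total_def round_up_le_iff[OF \<delta>] \<zeta>_def \<Delta>_def supp_def)
    then show ?thesis by (simp add: X\<^sub>3_def subtopology_subtopology)
  qed
  have subC: "obj (cech p P) r = subtopology X\<^sub>2 {a. \<gamma> a \<le> r}" for r
  proof -
    have "\<Delta> \<inter> {a. \<gamma> a \<le> r} = realization_points (nerve P (\<lambda>i. pball p i r))"
      unfolding realization_points_nerve[OF P(1)] pball_def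
      using cech_radius_le_iff(1)[OF p supp]
      by (auto simp: \<gamma>_def \<Delta>_def supp_def)
    then show ?thesis
      by (simp add: cech_def geometric_realization_nerve[OF P(1)] X\<^sub>2_def subtopology_subtopology)
  qed
  have subO: "obj (offset p M) r = subtopology X\<^sub>1 {y. set_pdist p M y \<le> r}" for r
  proof -
    have "M \<noteq> {}" using P by blast
    then have "{y. set_pdist p M y \<le> r} = (\<Union>x\<in>M. pball p x r)"
      using set_pdist_le_iff(1)[OF p M] by (auto simp: pball_def)
    then show ?thesis by (simp add: offset_def X\<^sub>1_def)
  qed

  let ?C = "transport_rspace e\<^sub>2 (cech p P)" and ?O = "transport_rspace e\<^sub>1 (offset p M)"
  let ?C\<^sub>1 = "?S e\<^sub>2 X\<^sub>2 \<gamma>" and ?C\<^sub>2 = "?S e\<^sub>2 X\<^sub>2 (?h \<circ> \<gamma>)" and ?Z = "?S e\<^sub>3 X\<^sub>3 (?h \<circ> \<zeta>)"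
  let ?O\<^sub>2 = "?S e\<^sub>1 X\<^sub>1 (?h \<circ> set_pdist p P)" and ?O\<^sub>1 = "?S e\<^sub>1 X\<^sub>1 (set_pdist p M)"
  have C: "is_rspace ?C" "weakly_equivalent ?C ?C\<^sub>1"
    by (rule transport_rspace_cong[OF e(2) X2 subC]; simp add: cech_def)+
  have O: "is_rspace ?O" "weakly_equivalent ?O ?O\<^sub>1"
    by (rule transport_rspace_cong[OF e(1) X1 subO]; simp add: offset_def)+
  have rs: "is_rspace ?C\<^sub>1" "is_rspace ?C\<^sub>2" "is_rspace ?Z" "is_rspace ?O\<^sub>2" "is_rspace ?O\<^sub>1"
    using is_rspace_sublevel metrizable_transport_topology e e3 X1 X2 X3 by blast+
  have ZC: "weakly_equivalent ?Z ?C\<^sub>2"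
    by (rule weakly_equivalent_sublevel[OF e3 e(2) X3 X2], unfold sub2 sub3)
      (rule pointed_homotopy_equivalence_nerve_total_snd[OF P(1) convex_pnorm_ball[OF p]])
  have ZO: "weakly_equivalent ?Z ?O\<^sub>2"
    by (rule weakly_equivalent_sublevel[OF e3 e(1) X3 X1], unfold sub1 sub3)
      (rule pointed_homotopy_equivalence_nerve_total_fst[OF P(1) open_pnorm_ball[OF p]])
  have inv: "d U V = 0" if "is_rspace U" "is_rspace V" "weakly_equivalent U V" for U V
    using d(3) that by (simp add: homotopy_invariant_distance_def)
  have stab: "d (?S e X \<alpha>) (?S e X \<beta>) \<le> ennreal c"
    if "inj e" "metrizable_space X" "\<And>x. \<bar>\<alpha> x - \<beta> x\<bar> \<le> c" for e and X :: "'c topology" and \<alpha> \<beta> c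
  proof -
    have "d (?S e X \<alpha>) (?S e X \<beta>) \<le> sup_distance (transport_topology e X) (\<alpha> \<circ> inv e) (\<beta> \<circ> inv e)"
      using d(2) CGWH_metrizable[OF metrizable_transport_topology[OF that(1,2)]]
      unfolding stable_distance_def by blast
    also have "\<dots> \<le> ennreal c" using that(3) by (intro sup_distance_le) simp
    finally show ?thesis .
  qed
  have sym: "d U V = d V U" and tri: "is_rspace W \<Longrightarrow> d U V \<le> d U W + d W V"
    if "is_rspace U" "is_rspace V" for U V W
    using d(1) that unfolding rspace_distance_def by blast+
  have "d ?C\<^sub>1 ?C\<^sub>2 \<le> ennreal \<delta>"
    using round_up_near[OF \<delta>] by (intro stab e X2) (simp add: abs_minus_commute)
  \<comment> \<open>One \<open>\<delta>\<close> for rounding, one for passing from the sample to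
    \<open>M\<close>.\<close>
  moreover have "d ?O\<^sub>2 ?O\<^sub>1 \<le> ennreal (2 * \<delta>)"
  proof (intro stab e X1)
    fix y
    show "\<bar>(?h \<circ> set_pdist p P) y - set_pdist p M y\<bar> \<le> 2 * \<delta>"
      using round_up_near[OF \<delta>, of "set_pdist p P y"] set_pdist_near[OF p M P dense, of y] by simp
  qed
  ultimately have "d ?C\<^sub>1 ?C\<^sub>2 + d ?O\<^sub>2 ?O\<^sub>1 \<le> ennreal (3 * \<delta>)"
    using \<delta> add_mono[of "d ?C\<^sub>1 ?C\<^sub>2" "ennreal \<delta>" "d ?O\<^sub>2 ?O\<^sub>1" "ennreal (2 * \<delta>)"]
    by (simp flip: ennreal_plus)
  moreover have "d ?C ?C\<^sub>1 = 0" "d ?Z ?C\<^sub>2 = 0" "d ?Z ?O\<^sub>2 = 0" "d ?O ?O\<^sub>1 = 0"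
    using inv C O rs ZC ZO by blast+
  \<comment> \<open>The triangle inequality along the whole chain; all summands but the two
    stability estimates vanish.\<close>
  moreover have "d ?C ?O \<le> d ?C ?C\<^sub>1 + (d ?C\<^sub>1 ?C\<^sub>2 + (d ?C\<^sub>2 ?Z + (d ?Z ?O\<^sub>2 + (d ?O\<^sub>2 ?O\<^sub>1 + d ?O\<^sub>1 ?O))))"
    using C(1) O(1) rs by (intro order_trans[OF tri add_left_mono] order_refl)
  ultimately show ?thesis
    using sym[OF rs(2,3)] sym[OF rs(5) O(1)] by simp
qed

theorem proposition6p13:
  fixes p :: ereal
    and M :: "(real ^ 'n) set" and k :: nat
    and \<Omega> :: "nat \<Rightarrow> 'w measure" and X :: "nat \<Rightarrow> nat \<Rightarrow> 'w \<Rightarrow> real ^ 'n"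
    and d :: "'u rspace \<Rightarrow> 'u rspace \<Rightarrow> ennreal"
    and e\<^sub>1 :: "real ^ 'n \<Rightarrow> 'u" and e\<^sub>2 :: "(real ^ 'n \<Rightarrow> real) \<Rightarrow> 'u"
    and \<epsilon> :: real
  assumes "1 \<le> p"
    and "compact M" and "smooth_submanifold k M"
    and "\<And>m. m \<ge> 1 \<Longrightarrow> iid_sample (\<Omega> m) (normalized_hausdorff_measure k M) m (X m)"
    and "inj e\<^sub>1" and "inj e\<^sub>2"
    and "rspace_distance d" and "stable_distance d" and "homotopy_invariant_distance d"
    and "\<epsilon> > 0"
  shows "(\<lambda>m. outer_measure_of (\<Omega> m)
            {\<omega> \<in> space (\<Omega> m).
               d (transport_rspace e\<^sub>2 (cech p (sample_set m (X m) \<omega>)))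
                 (transport_rspace e\<^sub>1 (offset p M)) > ennreal \<epsilon>})
         \<longlonglongrightarrow> 0"
proof -
  let ?\<mu> = "normalized_hausdorff_measure k M"
  \<comment> \<open>The factor 3 is the error constant of
    \<open>cech_offset_distance\<close>.\<close>
  define \<delta> where "\<delta> = \<epsilon> / 3"
  have \<delta>: "0 < \<delta>" using assms(10) by (simp add: \<delta>_def)
  obtain \<eta> where \<eta>: "0 < \<eta>" "\<And>x y :: real ^ 'n. dist x y < \<eta> \<Longrightarrow> pnorm p (x - y) < \<delta>"
    using pnorm_less_near[OF assms(1) \<delta>] by metis
  have prob: "prob_space ?\<mu>"
    using prob_space_sample_law[OF _ assms(4)[of 1]] by simp
  have pos: "0 < emeasure ?\<mu> (M \<inter> ball x r)" if "x \<in> M" "0 < r" for x r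
    by (intro emeasure_normalized_hausdorff_measure_pos[OF prob]
        hausdorff_outer_measure_submanifold_ball_pos assms that)
      (auto simp: sets_restrict_space)
  let ?sparse = "\<lambda>m. {\<omega> \<in> space (\<Omega> m). \<not> (\<forall>x\<in>M. \<exists>y\<in>sample_set m (X m) \<omega>. dist x y < \<eta>)}"
  let ?far = "\<lambda>m. {\<omega> \<in> space (\<Omega> m). d (transport_rspace e\<^sub>2 (cech p (sample_set m (X m) \<omega>)))
                 (transport_rspace e\<^sub>1 (offset p M)) > ennreal \<epsilon>}"
  have lim: "(\<lambda>m. outer_measure_of (\<Omega> m) (?sparse m)) \<longlonglongrightarrow> 0"
    by (rule sample_becomes_dense[OF assms(2,4) _ _ pos \<eta>(1)]) auto
  \<comment> \<open>Outer measure is monotone on all sets, so inclusion of events is enough even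
    though \<open>d\<close> is arbitrary and the event on the left may fail to be
    measurable.\<close>
  have "outer_measure_of (\<Omega> m) (?far m) \<le> outer_measure_of (\<Omega> m) (?sparse m)" if m: "1 \<le> m" for m
  proof (rule outer_measure_of_mono, safe)
    fix \<omega> assume \<omega>: "\<omega> \<in> space (\<Omega> m)"
      and far: "ennreal \<epsilon> < d (transport_rspace e\<^sub>2 (cech p (sample_set m (X m) \<omega>)))
                 (transport_rspace e\<^sub>1 (offset p M))"
      and dense: "\<forall>x\<in>M. \<exists>y\<in>sample_set m (X m) \<omega>. dist x y < \<eta>"
    have "d (transport_rspace e\<^sub>2 (cech p (sample_set m (X m) \<omega>)))
        (transport_rspace e\<^sub>1 (offset p M)) \<le> ennreal (3 * \<delta>)"
    proof (rule cech_offset_distance[OF assms(1,2) _ _ _ \<delta> _ assms(5-9)])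
      show "finite (sample_set m (X m) \<omega>)" by (simp add: sample_set_def)
      show "sample_set m (X m) \<omega> \<noteq> {}" using m by (auto simp: sample_set_def lessThan_empty_iff)
      show "sample_set m (X m) \<omega> \<subseteq> M" using sample_set_in_space[OF assms(4)[OF m] \<omega>] by simp
      show "\<exists>z\<in>sample_set m (X m) \<omega>. pnorm p (x - z) < \<delta>" if "x \<in> M" for x
        using dense that \<eta>(2) by blast
    qed
    then show False using far by (simp add: \<delta>_def)
  qed
  then have "\<forall>\<^sub>F m in sequentially. outer_measure_of (\<Omega> m) (?far m) \<le> outer_measure_of (\<Omega> m) (?sparse m)"
    using eventually_ge_at_top[of 1] by (rule eventually_mono[rotated])
  then show ?thesis
    by (rule tendsto_sandwich[OF _ _ tendsto_const lim, rotated]) simp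
qed

end
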